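(* Let $M$ be a smooth manifold with a symmetric affine connection $\nabla$. The following statements are equivalent. (i) The affine manifold $(M,\nabla)$ is curvature-flat, i.e. $R^l_{\ ijk}=0$ on $M$. (ii) Around each point of $M$ there exists a chart in which $\Gamma^i_{jk}=0$ (identically on the chart domain). (iii) Around each point of $M$ there exists a chart in which, identically on the chart domain, $$\frac{\partial}{\partial x^p}\Gamma^l_{is}=0\quad\text{and}\quad\Gamma^l_{pn} \Gamma^n_{is}=0\quad(\text{all } p,l,i,s).$$ (iv) Around each point of $M$ there exists a chart in which, identically on the chart domain, $$\frac{\partial}{\partial x^p}\Gamma^l_{is}+ \Gamma^l_{pn} \Gamma^n_{is}=0\quad(\text{all } p,l,i,s).$$
   Context: The $\Gamma^i_{jk}=\Gamma^i_{kj}$ denote the ($C^\infty$) components of $\nabla$ in a chart, and $R^l_{\ ijk}= \frac{\partial}{\partial x^j}\Gamma^l_{ik} - \frac{\partial}{\partial x^k}\Gamma^l_{ij}+ \Gamma^l_{js} \Gamma^s_{ik} - \Gamma^l_{ks} \Gamma^s_{ij}$ are the components of the curvature tensor. Summation over repeated indices from $1$ to $\dim M$ is understood (including the dummy index $n$ in the products). *)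

theory Defs
  imports "HOL-Analysis.Analysis"
begin

section \<open>Smooth functions on open subsets of Euclidean space\<close>

primrec Ck_on :: "nat \<Rightarrow> 'e::euclidean_space set \<Rightarrow> ('e \<Rightarrow> 'b::real_normed_vector) \<Rightarrow> bool" where
  "Ck_on 0 S f \<longleftrightarrow> continuous_on S f"
| "Ck_on (Suc k) S f \<longleftrightarrow>
     (\<forall>x\<in>S. f differentiable (at x)) \<and>
     (\<forall>v. Ck_on k S (\<lambda>x. frechet_derivative f (at x) v))"

text \<open>Only used for open \<open>S\<close>, so that it depends only on the values of \<open>f\<close> on \<open>S\<close>.\<close>

definition smooth_on :: "'e::euclidean_space set \<Rightarrow> ('e \<Rightarrow> 'b::real_normed_vector) \<Rightarrow> bool" where
  "smooth_on S f \<longleftrightarrow> (\<forall>k. Ck_on k S f)"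

definition partial_deriv :: "'n::finite \<Rightarrow> (real^'n \<Rightarrow> real) \<Rightarrow> real^'n \<Rightarrow> real" where
  "partial_deriv j f x = frechet_derivative f (at x) (axis j 1)"


section \<open>Smooth manifolds\<close>

text \<open>A chart is a pair of a domain and a coordinate map; the values of the coordinate map
  outside the domain are irrelevant.\<close>

type_synonym ('a, 'n) chart = "'a set \<times> ('a \<Rightarrow> real^'n)"

abbreviation chart_dom :: "('a, 'n) chart \<Rightarrow> 'a set" where
  "chart_dom c \<equiv> fst c"

abbreviation chart_map :: "('a, 'n) chart \<Rightarrow> 'a \<Rightarrow> real^'n" where
  "chart_map c \<equiv> snd c"

definition is_chart :: "'a topology \<Rightarrow> ('a, 'n::finite) chart \<Rightarrow> bool" where
  "is_chart M c \<longleftrightarrow>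
     openin M (chart_dom c) \<and> open (chart_map c ` chart_dom c) \<and>
     homeomorphic_map (subtopology M (chart_dom c))
       (top_of_set (chart_map c ` chart_dom c)) (chart_map c)"

text \<open>The expression of \<open>f\<close> in the coordinates of \<open>c\<close>; meaningful on
  \<open>chart_map c ` chart_dom c\<close>.\<close>

definition in_coords :: "('a, 'n) chart \<Rightarrow> ('a \<Rightarrow> 'b) \<Rightarrow> real^'n \<Rightarrow> 'b" where
  "in_coords c f = f \<circ> inv_into (chart_dom c) (chart_map c)"

definition smooth_compatible :: "('a, 'n::finite) chart \<Rightarrow> ('a, 'n) chart \<Rightarrow> bool" where
  "smooth_compatible c c' \<longleftrightarrow>
     smooth_on (chart_map c ` (chart_dom c \<inter> chart_dom c')) (in_coords c (chart_map c')) \<and>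
     smooth_on (chart_map c' ` (chart_dom c \<inter> chart_dom c')) (in_coords c' (chart_map c))"

text \<open>The smooth structure is given by its maximal atlas, so a chart of the manifold is just
  an element of \<open>A\<close>.\<close>

definition smooth_manifold :: "'a topology \<Rightarrow> ('a, 'n::finite) chart set \<Rightarrow> bool" where
  "smooth_manifold M A \<longleftrightarrow>
     Hausdorff_space M \<and> second_countable M \<and>
     (\<Union>c\<in>A. chart_dom c) = topspace M \<and>
     (\<forall>c. c \<in> A \<longleftrightarrow> is_chart M c \<and> (\<forall>c'\<in>A. smooth_compatible c c'))"

definition smooth_fun :: "('a, 'n::finite) chart set \<Rightarrow> 'a set \<Rightarrow> ('a \<Rightarrow> real) \<Rightarrow> bool" where
  "smooth_fun A U f \<longleftrightarrow>
     (\<forall>c\<in>A. smooth_on (chart_map c ` (U \<inter> chart_dom c)) (in_coords c f))"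


section \<open>Vector fields\<close>

text \<open>A tangent vector at \<open>p\<close> assigns to each chart around \<open>p\<close> a component vector in
  \<open>real^'n\<close>, the components in different charts being related by the Jacobian of the
  coordinate change. Accordingly \<open>X c p\<close> is the component vector at \<open>p\<close> of the field \<open>X\<close>
  in the chart \<open>c\<close>; for \<open>p \<notin> chart_dom c\<close> it is irrelevant.\<close>

type_synonym ('a, 'n) vfield = "('a, 'n) chart \<Rightarrow> 'a \<Rightarrow> real^'n"

definition smooth_vfield ::
    "('a, 'n::finite) chart set \<Rightarrow> 'a set \<Rightarrow> ('a, 'n) vfield \<Rightarrow> bool" where
  "smooth_vfield A U X \<longleftrightarrow>
     (\<forall>c\<in>A. smooth_on (chart_map c ` (U \<inter> chart_dom c)) (in_coords c (X c))) \<and>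
     (\<forall>c\<in>A. \<forall>c'\<in>A. \<forall>p \<in> U \<inter> chart_dom c \<inter> chart_dom c'.
        X c' p = frechet_derivative (in_coords c (chart_map c')) (at (chart_map c p)) (X c p))"

definition vfield_eq ::
    "('a, 'n) chart set \<Rightarrow> 'a set \<Rightarrow> ('a, 'n) vfield \<Rightarrow> ('a, 'n) vfield \<Rightarrow> bool" where
  "vfield_eq A U X Y \<longleftrightarrow> (\<forall>c\<in>A. \<forall>p \<in> U \<inter> chart_dom c. X c p = Y c p)"

definition vfield_add ::
    "('a, 'n::finite) vfield \<Rightarrow> ('a, 'n) vfield \<Rightarrow> ('a, 'n) vfield" where
  "vfield_add X Y = (\<lambda>c p. X c p + Y c p)"

definition vfield_mult :: "('a \<Rightarrow> real) \<Rightarrow> ('a, 'n::finite) vfield \<Rightarrow> ('a, 'n) vfield" where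
  "vfield_mult f X = (\<lambda>c p. f p *\<^sub>R X c p)"

text \<open>The derivative \<open>X f\<close> at \<open>p\<close>, computed in the chart \<open>c\<close> around \<open>p\<close>; by the chain rule it
  does not depend on \<open>c\<close>.\<close>

definition vfield_apply ::
    "('a, 'n::finite) chart \<Rightarrow> ('a, 'n) vfield \<Rightarrow> ('a \<Rightarrow> real) \<Rightarrow> 'a \<Rightarrow> real" where
  "vfield_apply c X f p = frechet_derivative (in_coords c f) (at (chart_map c p)) (X c p)"

text \<open>The coordinate field \<open>\<partial>/\<partial>x\<^sup>j\<close> of the chart \<open>c\<close>, a vector field on \<open>chart_dom c\<close>.\<close>

definition coord_vfield :: "('a, 'n::finite) chart \<Rightarrow> 'n \<Rightarrow> ('a, 'n) vfield" where
  "coord_vfield c j =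
     (\<lambda>c' p. frechet_derivative (in_coords c (chart_map c')) (at (chart_map c p)) (axis j 1))"


section \<open>Affine connections\<close>

text \<open>\<open>nabla U X Y\<close> is the covariant derivative of \<open>Y\<close> along \<open>X\<close>, for vector fields on the open
  set \<open>U\<close>. A connection given on global fields only is a local operator and hence acts on
  fields over every open subset; here this action is part of the data, and the compatibility
  with restriction is the second clause.\<close>

type_synonym ('a, 'n) cov_deriv =
  "'a set \<Rightarrow> ('a, 'n) vfield \<Rightarrow> ('a, 'n) vfield \<Rightarrow> ('a, 'n) vfield"

definition affine_connection ::
    "'a topology \<Rightarrow> ('a, 'n::finite) chart set \<Rightarrow> ('a, 'n) cov_deriv \<Rightarrow> bool" where
  "affine_connection M A nabla \<longleftrightarrow>
     (\<forall>U X Y. openin M U \<and> smooth_vfield A U X \<and> smooth_vfield A U Y \<longrightarrow>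
        smooth_vfield A U (nabla U X Y)) \<and>
     (\<forall>U V X Y X' Y'. openin M U \<and> openin M V \<and> V \<subseteq> U \<and>
        smooth_vfield A U X \<and> smooth_vfield A U Y \<and>
        smooth_vfield A V X' \<and> smooth_vfield A V Y' \<and>
        vfield_eq A V X X' \<and> vfield_eq A V Y Y' \<longrightarrow>
        vfield_eq A V (nabla U X Y) (nabla V X' Y')) \<and>
     (\<forall>U X X' Y. openin M U \<and> smooth_vfield A U X \<and> smooth_vfield A U X' \<and>
        smooth_vfield A U Y \<longrightarrow>
        vfield_eq A U (nabla U (vfield_add X X') Y) (vfield_add (nabla U X Y) (nabla U X' Y))) \<and>
     (\<forall>U f X Y. openin M U \<and> smooth_fun A U f \<and> smooth_vfield A U X \<and> smooth_vfield A U Y \<longrightarrow>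
        vfield_eq A U (nabla U (vfield_mult f X) Y) (vfield_mult f (nabla U X Y))) \<and>
     (\<forall>U X Y Y'. openin M U \<and> smooth_vfield A U X \<and> smooth_vfield A U Y \<and>
        smooth_vfield A U Y' \<longrightarrow>
        vfield_eq A U (nabla U X (vfield_add Y Y')) (vfield_add (nabla U X Y) (nabla U X Y'))) \<and>
     (\<forall>U f X Y. openin M U \<and> smooth_fun A U f \<and> smooth_vfield A U X \<and> smooth_vfield A U Y \<longrightarrow>
        (\<forall>c\<in>A. \<forall>p \<in> U \<inter> chart_dom c.
           nabla U X (vfield_mult f Y) c p =
             f p *\<^sub>R nabla U X Y c p + vfield_apply c X f p *\<^sub>R Y c p))"

text \<open>The component \<open>\<Gamma>\<^sup>i\<^bsub>jk\<^esub>\<close> in the chart \<open>c\<close>, as a function of the coordinates; it is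
  determined by \<open>\<nabla>\<^bsub>\<partial>j\<^esub> \<partial>\<^bsub>k\<^esub> = \<Gamma>\<^sup>i\<^bsub>jk\<^esub> \<partial>\<^bsub>i\<^esub>\<close>.\<close>

definition christoffel ::
    "('a, 'n::finite) cov_deriv \<Rightarrow> ('a, 'n) chart \<Rightarrow> 'n \<Rightarrow> 'n \<Rightarrow> 'n \<Rightarrow> real^'n \<Rightarrow> real" where
  "christoffel nabla c i j k =
     in_coords c (\<lambda>p. nabla (chart_dom c) (coord_vfield c j) (coord_vfield c k) c p $ i)"

definition symmetric_affine_connection ::
    "'a topology \<Rightarrow> ('a, 'n::finite) chart set \<Rightarrow> ('a, 'n) cov_deriv \<Rightarrow> bool" where
  "symmetric_affine_connection M A nabla \<longleftrightarrow>
     affine_connection M A nabla \<and>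
     (\<forall>c\<in>A. \<forall>x \<in> chart_map c ` chart_dom c. \<forall>i j k.
        christoffel nabla c i j k x = christoffel nabla c i k j x)"

text \<open>The component \<open>R\<^sup>l\<^bsub>ijk\<^esub>\<close> of the curvature tensor.\<close>

definition curvature ::
    "('a, 'n::finite) cov_deriv \<Rightarrow> ('a, 'n) chart \<Rightarrow> 'n \<Rightarrow> 'n \<Rightarrow> 'n \<Rightarrow> 'n \<Rightarrow> real^'n \<Rightarrow> real" where
  "curvature nabla c l i j k x =
     (let \<Gamma> = christoffel nabla c in
        partial_deriv j (\<Gamma> l i k) x - partial_deriv k (\<Gamma> l i j) x
        + (\<Sum>s\<in>UNIV. \<Gamma> l j s x * \<Gamma> s i k x) - (\<Sum>s\<in>UNIV. \<Gamma> l k s x * \<Gamma> s i j x))"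

definition curvature_flat ::
    "('a, 'n::finite) chart set \<Rightarrow> ('a, 'n) cov_deriv \<Rightarrow> bool" where
  "curvature_flat A nabla \<longleftrightarrow>
     (\<forall>c\<in>A. \<forall>x \<in> chart_map c ` chart_dom c. \<forall>l i j k. curvature nabla c l i j k x = 0)"

end

(* Vanishing of the curvature is exactly the integrability condition of the linear system
   d_j d_k phi = Gamma^i_jk d_i phi, whose solutions phi with invertible differential are the
   coordinates with vanishing Christoffel symbols; these new coordinates are charts of the maximal
   atlas by the inverse function theorem. A flat linear system is solved by Picard iteration along
   the segments from the base point: by flatness the defect of the k-th iterate tends to 0
   uniformly, so no regularity theory for ordinary differential equations is needed. Conversely, if
   the system has such a solution, the symmetry of the third derivatives of phi forces the
   curvature to vanish. Condition (iv) is an instance of the integrability condition in its own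
   chart, so it yields (ii) without invoking the tensoriality of the curvature. *)

theory Submission
  imports Defs
begin

section \<open>Calculus of \<open>C\<^sup>k\<close> functions\<close>

text \<open>The equation for \<phi> is the transformation law of the Christoffel symbols with zero
  symbols in the new chart. So flat charts correspond to solutions with invertible differential, and
  in both directions curvature enters only as the integrability condition in the old chart. As a
  first-order system the unknown is the pair of \<omega> = d \<phi> and \<phi>. Carrying \<phi>
  along avoids a separate Poincare lemma: the symmetry of \<Gamma> makes the enlarged system flat.
  The obstacle is that a Picard step integrates along rays, so it is not evident that the limit
  satisfies the equation in directions transversal to them. The iteration therefore controls the
  defect w' - B w in all directions: after an integration by parts along the segment, flatness turns
  the new defect, measured against the old iterate, into an integral of the old one. On a ball with
  K \<rho> \<le> 1/4 a step halves the bound for it, and also the bound for the difference of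
  successive iterates.\<close>

lemma Ck_on_cong:
  assumes "open S" "\<And>x. x \<in> S \<Longrightarrow> f x = g x" "Ck_on k S f"
  shows "Ck_on k S g"
  using assms
proof (induction k arbitrary: f g)
  case 0
  then show ?case by (metis Ck_on.simps(1) continuous_on_cong)
next
  case (Suc k)
  have der: "(g has_derivative frechet_derivative f (at x)) (at x)" if "x \<in> S" for x
  proof (rule has_derivative_transform_within_open[OF _ Suc.prems(1) that])
    show "(f has_derivative frechet_derivative f (at x)) (at x)"
      using Suc.prems(3) that by (simp flip: frechet_derivative_works)
  qed (use Suc.prems(2) in auto)
  have eq: "frechet_derivative f (at x) = frechet_derivative g (at x)" if "x \<in> S" for x
    using frechet_derivative_at[OF der[OF that]] .
  have "Ck_on k S (\<lambda>x. frechet_derivative g (at x) v)" for v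
    using Suc.IH[OF Suc.prems(1), of "\<lambda>x. frechet_derivative f (at x) v"] eq Suc.prems(3) by simp
  then show ?case using der by (auto simp: differentiable_def)
qed

lemma Ck_on_mono: "T \<subseteq> S \<Longrightarrow> Ck_on k S f \<Longrightarrow> Ck_on k T f"
  by (induction k arbitrary: f) (auto intro: continuous_on_subset)

text \<open>\<open>frechet_derivative\<close> is a choice operator; this rule lets closure proofs
  work with an explicit derivative, considered in one fixed direction at a time.\<close>

lemma Ck_on_SucI:
  assumes "open S" "\<And>x. x \<in> S \<Longrightarrow> (f has_derivative f' x) (at x)"
    and "\<And>v. Ck_on k S (\<lambda>x. f' x v)"
  shows "Ck_on (Suc k) S f"
proof -
  have "f' x = frechet_derivative f (at x)" if "x \<in> S" for x
    using frechet_derivative_at assms(2) that by blast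
  then have "Ck_on k S (\<lambda>x. frechet_derivative f (at x) v)" for v
    by (intro Ck_on_cong[OF assms(1) _ assms(3)[of v]]) metis
  then show ?thesis using assms(2) by (auto simp: differentiable_def)
qed

lemma Ck_on_has_derivative:
  "Ck_on (Suc k) S f \<Longrightarrow> x \<in> S \<Longrightarrow> (f has_derivative frechet_derivative f (at x)) (at x)"
  by (simp flip: frechet_derivative_works)

lemma Ck_on_frechet: "Ck_on (Suc k) S f \<Longrightarrow> Ck_on k S (\<lambda>x. frechet_derivative f (at x) v)"
  by simp

lemma Ck_on_Suc_D: "Ck_on (Suc k) S f \<Longrightarrow> Ck_on k S f"
proof (induction k arbitrary: f)
  case 0
  then show ?case
    by (auto intro!: continuous_at_imp_continuous_on differentiable_imp_continuous_within)
next
  case (Suc k)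
  then show ?case by (metis Ck_on.simps(2))
qed

lemma Ck_on_le: "Ck_on k S f \<Longrightarrow> l \<le> k \<Longrightarrow> Ck_on l S f"
  by (induction k) (use Ck_on_Suc_D le_Suc_eq in blast)+

lemma Ck_on_continuous: "Ck_on k S f \<Longrightarrow> continuous_on S f"
  using Ck_on_le[of k S f 0] by simp

lemma Ck_on_const: "Ck_on k S (\<lambda>x. c)"
  by (induction k arbitrary: c) simp_all

lemma Ck_on_bounded_linear:
  assumes "open S" "bounded_linear L" "Ck_on k S f"
  shows "Ck_on k S (\<lambda>x. L (f x))"
  using assms(3)
proof (induction k arbitrary: f)
  case 0
  then show ?case using bounded_linear.continuous_on[OF assms(2)] by simp
next
  case (Suc k)
  show ?case
    by (rule Ck_on_SucI[OF assms(1), where f'="\<lambda>x h. L (frechet_derivative f (at x) h)"])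
      (intro bounded_linear.has_derivative[OF assms(2)] Suc.IH Ck_on_has_derivative[OF Suc.prems]
        Ck_on_frechet[OF Suc.prems] | assumption)+
qed

lemma Ck_on_add:
  assumes "open S" "Ck_on k S f" "Ck_on k S g"
  shows "Ck_on k S (\<lambda>x. f x + g x)"
  using assms(2,3)
proof (induction k arbitrary: f g)
  case (Suc k)
  show ?case
    by (rule Ck_on_SucI[OF assms(1), where
          f'="\<lambda>x h. frechet_derivative f (at x) h + frechet_derivative g (at x) h"])
      (intro has_derivative_add Suc.IH Ck_on_has_derivative[OF Suc.prems(1)]
        Ck_on_has_derivative[OF Suc.prems(2)] Suc.prems[THEN Ck_on_frechet] | assumption)+
qed (simp add: continuous_on_add)

lemma Ck_on_sum:
  assumes "open S" "\<And>i. i \<in> I \<Longrightarrow> Ck_on k S (f i)"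
  shows "Ck_on k S (\<lambda>x. \<Sum>i\<in>I. f i x)"
  using assms(2)
  by (induction I rule: infinite_finite_induct) (auto intro: Ck_on_const Ck_on_add[OF assms(1)])

text \<open>Each term of the product rule is again \<open>B\<close> of one factor and a derivative
  of the other, so the induction hypothesis applies once the order of the underived factor is
  lowered. Scalar multiples, products and application of \<open>blinfun\<close> maps are
  instances.\<close>

lemma Ck_on_bilinear:
  assumes "open S" "bounded_bilinear B" "Ck_on k S f" "Ck_on k S g"
  shows "Ck_on k S (\<lambda>x. B (f x) (g x))"
  using assms(3,4)
proof (induction k arbitrary: f g)
  case 0
  then show ?case using bounded_bilinear.continuous_on[OF assms(2)] by simp
next
  case (Suc k)
  show ?case
  proof (rule Ck_on_SucI[OF assms(1), where
          f'="\<lambda>x h. B (f x) (frechet_derivative g (at x) h) + B (frechet_derivative f (at x) h) (g x)"])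
    fix x assume "x \<in> S"
    with Suc.prems bounded_bilinear.FDERIV[OF assms(2) Ck_on_has_derivative Ck_on_has_derivative]
    show "((\<lambda>x. B (f x) (g x)) has_derivative
       (\<lambda>h. B (f x) (frechet_derivative g (at x) h) + B (frechet_derivative f (at x) h) (g x))) (at x)"
      by blast
  next
    fix v
    show "Ck_on k S (\<lambda>x. B (f x) (frechet_derivative g (at x) v) + B (frechet_derivative f (at x) v) (g x))"
      using Suc.prems by (intro Ck_on_add[OF assms(1)] Suc.IH) (blast intro: Ck_on_Suc_D Ck_on_frechet)+
  qed
qed

lemmas Ck_on_scaleR = Ck_on_bilinear[OF _ bounded_bilinear_scaleR]
lemmas Ck_on_mult = Ck_on_bilinear[OF _ bounded_bilinear_mult]

lemma Ck_on_prod: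
  fixes f :: "'i \<Rightarrow> 'e::euclidean_space \<Rightarrow> real"
  assumes "open S" "\<And>i. i \<in> I \<Longrightarrow> Ck_on k S (f i)"
  shows "Ck_on k S (\<lambda>x. \<Prod>i\<in>I. f i x)"
  using assms(2)
  by (induction I rule: infinite_finite_induct) (auto intro: Ck_on_const Ck_on_mult[OF assms(1)])

text \<open>The derivative -(1/f) f' (1/f) contains 1/f again; the induction hypothesis gives it
  order k, and this raises 1/f to order k + 1.\<close>

lemma Ck_on_inverse:
  fixes f :: "'e::euclidean_space \<Rightarrow> real"
  assumes "open S" "\<And>x. x \<in> S \<Longrightarrow> f x \<noteq> 0" "Ck_on k S f"
  shows "Ck_on k S (\<lambda>x. inverse (f x))"
  using assms(3)
proof (induction k)
  case 0
  then show ?case using assms(2) by (auto intro!: continuous_on_inverse)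
next
  case (Suc k)
  note IH = Suc.IH[OF Ck_on_Suc_D[OF Suc.prems]]
  show ?case
  proof (rule Ck_on_SucI[OF assms(1), where
          f'="\<lambda>x h. - (inverse (f x) * frechet_derivative f (at x) h * inverse (f x))"])
    fix x assume "x \<in> S"
    then show "((\<lambda>x. inverse (f x)) has_derivative
       (\<lambda>h. - (inverse (f x) * frechet_derivative f (at x) h * inverse (f x)))) (at x)"
      by (intro Deriv.has_derivative_inverse Ck_on_has_derivative[OF Suc.prems] assms(2))
  next
    fix v
    have "Ck_on k S (\<lambda>x. frechet_derivative f (at x) v)" using Suc.prems by simp
    then show "Ck_on k S (\<lambda>x. - (inverse (f x) * frechet_derivative f (at x) v * inverse (f x)))"
      by (intro Ck_on_bounded_linear[OF assms(1) bounded_linear_minus[OF bounded_linear_ident]]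
           Ck_on_mult[OF assms(1)] IH)
  qed
qed

text \<open>In the chain rule the direction in which \<open>g\<close> is differentiated moves with
  the point, whereas \<open>Ck_on\<close> controls fixed directions only. Expanding that direction
  in \<open>Basis\<close> leaves coordinates of the derivative of \<open>f\<close> times fixed
  directional derivatives of \<open>g\<close>, composed with \<open>f\<close>.\<close>

lemma Ck_on_compose:
  fixes f :: "'d::euclidean_space \<Rightarrow> 'e::euclidean_space"
  assumes "open S" "open T" "f ` S \<subseteq> T" "Ck_on k S f" "Ck_on k T g"
  shows "Ck_on k S (\<lambda>x. g (f x))"
  using assms(4,5)
proof (induction k arbitrary: g)
  case 0
  then show ?case using continuous_on_compose2[OF _ _ assms(3)] by simp
next
  case (Suc k)
  let ?f' = "\<lambda>x h. \<Sum>b\<in>Basis. (frechet_derivative f (at x) h \<bullet> b) *\<^sub>R frechet_derivative g (at (f x)) b"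
  show ?case
  proof (rule Ck_on_SucI[OF assms(1), where f'="?f'"])
    fix x assume x: "x \<in> S"
    then have fx: "f x \<in> T" using assms(3) by blast
    have g: "(g has_derivative frechet_derivative g (at (f x))) (at (f x))"
      using Ck_on_has_derivative[OF Suc.prems(2) fx] .
    interpret L: bounded_linear "frechet_derivative g (at (f x))"
      using g by (rule has_derivative_bounded_linear)
    have rep: "frechet_derivative g (at (f x)) w = (\<Sum>b\<in>Basis. (w \<bullet> b) *\<^sub>R frechet_derivative g (at (f x)) b)" for w
      using L.sum[of "\<lambda>b. (w \<bullet> b) *\<^sub>R b" Basis] by (simp add: L.scaleR euclidean_representation)
    have "?f' x = (\<lambda>h. frechet_derivative g (at (f x)) (frechet_derivative f (at x) h))"
      by (intro ext) (rule rep[symmetric])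
    then show "((\<lambda>x. g (f x)) has_derivative ?f' x) (at x)"
      using has_derivative_compose[OF Ck_on_has_derivative[OF Suc.prems(1) x] g] by simp
  next
    fix v
    have "Ck_on k S (\<lambda>x. frechet_derivative f (at x) v)"
      and g: "\<And>b. Ck_on k T (\<lambda>x. frechet_derivative g (at x) b)"
      using Suc.prems by auto
    then show "Ck_on k S (\<lambda>x. ?f' x v)"
      by (intro Ck_on_sum Ck_on_scaleR assms(1) Suc.IH Ck_on_Suc_D[OF Suc.prems(1)] g
          Ck_on_bounded_linear[OF _ bounded_linear_inner_left])
  qed
qed

lemma Ck_on_vec:
  fixes f :: "'e::euclidean_space \<Rightarrow> real^'n"
  assumes "open S" "\<And>i. Ck_on k S (\<lambda>x. f x $ i)"
  shows "Ck_on k S f"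
proof -
  have "Ck_on k S (\<lambda>x. \<Sum>i\<in>UNIV. f x $ i *\<^sub>R axis i 1)" (is "Ck_on k S ?g")
    using assms by (intro Ck_on_sum Ck_on_scaleR Ck_on_const) auto
  moreover have "?g x = f x" for x
    using basis_expansion[where 'n='n and 'a=real] by (auto simp: scalar_mult_eq_scaleR)
  ultimately show ?thesis using Ck_on_cong[OF assms(1), of ?g f] by blast
qed

lemma Ck_on_nth: "open S \<Longrightarrow> Ck_on k S f \<Longrightarrow> Ck_on k S (\<lambda>x. f x $ i)"
  using Ck_on_bounded_linear[OF _ bounded_linear_vec_nth] .

lemma smooth_on_cong: "open S \<Longrightarrow> (\<And>x. x \<in> S \<Longrightarrow> f x = g x) \<Longrightarrow> smooth_on S f \<Longrightarrow> smooth_on S g"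
  unfolding smooth_on_def using Ck_on_cong by blast

lemma smooth_on_mono: "T \<subseteq> S \<Longrightarrow> smooth_on S f \<Longrightarrow> smooth_on T f"
  unfolding smooth_on_def using Ck_on_mono by blast

lemma smooth_on_compose:
  fixes f :: "'d::euclidean_space \<Rightarrow> 'e::euclidean_space"
  shows "open S \<Longrightarrow> open T \<Longrightarrow> f ` S \<subseteq> T \<Longrightarrow> smooth_on S f \<Longrightarrow> smooth_on T g \<Longrightarrow>
    smooth_on S (\<lambda>x. g (f x))"
  unfolding smooth_on_def using Ck_on_compose by blast

lemma smooth_on_frechet: "smooth_on S f \<Longrightarrow> smooth_on S (\<lambda>x. frechet_derivative f (at x) v)"
  unfolding smooth_on_def using Ck_on.simps(2) by blast

lemma smooth_on_has_derivative:
  "smooth_on S f \<Longrightarrow> x \<in> S \<Longrightarrow> (f has_derivative frechet_derivative f (at x)) (at x)"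
  unfolding smooth_on_def using Ck_on_has_derivative by blast

section \<open>Symmetry of second derivatives\<close>

lemma has_derivative_along_line:
  fixes f :: "'e::real_normed_vector \<Rightarrow> real"
  assumes "(f has_derivative D) (at (p b))" "\<And>b. p b = q + b *\<^sub>R v"
  shows "((\<lambda>b. f (p b)) has_derivative (\<lambda>h. h * D v)) (at b)"
proof -
  have "(p has_derivative (\<lambda>h. h *\<^sub>R v)) (at b)"
    unfolding assms(2)[abs_def] by (auto intro!: derivative_eq_intros)
  from has_derivative_compose[OF this assms(1)] show ?thesis
    by (simp add: linear_simps[OF has_derivative_bounded_linear[OF assms(1)]])
qed

text \<open>Two mean value theorems: the second difference over the parallelogram is a difference of
  \<open>G\<close> in direction \<open>u\<close>, and the resulting difference of first derivatives
  is then evaluated in direction \<open>v\<close>.\<close>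

lemma mixed_difference:
  fixes f :: "'e::euclidean_space \<Rightarrow> real"
  assumes C2: "Ck_on 2 S f" and s: "s > 0"
    and sub: "\<And>a b. a \<in> {0..s} \<Longrightarrow> b \<in> {0..s} \<Longrightarrow> x + a *\<^sub>R u + b *\<^sub>R v \<in> S"
  shows "\<exists>a\<in>{0..s}. \<exists>b\<in>{0..s}.
    f (x + s *\<^sub>R u + s *\<^sub>R v) - f (x + s *\<^sub>R u) - f (x + s *\<^sub>R v) + f x =
    s * s * frechet_derivative (\<lambda>y. frechet_derivative f (at y) u) (at (x + a *\<^sub>R u + b *\<^sub>R v)) v"
proof -
  let ?D = "\<lambda>y. frechet_derivative f (at y)"
  let ?E = "\<lambda>y. frechet_derivative (\<lambda>y. ?D y u) (at y)"
  have C2': "Ck_on (Suc (Suc 0)) S f" using C2 by (simp add: numeral_2_eq_2)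
  have D: "(f has_derivative ?D y) (at y)" if "y \<in> S" for y
    using Ck_on_has_derivative[OF C2' that] .
  have E: "((\<lambda>y. ?D y u) has_derivative ?E y) (at y)" if "y \<in> S" for y
    using Ck_on_has_derivative[of 0 S "\<lambda>y. ?D y u"] C2' that by auto
  define G where "G a = f (x + a *\<^sub>R u + s *\<^sub>R v) - f (x + a *\<^sub>R u)" for a
  have G: "(G has_derivative (\<lambda>h. h * (?D (x + a *\<^sub>R u + s *\<^sub>R v) u - ?D (x + a *\<^sub>R u) u))) (at a)"
    if a: "a \<in> {0..s}" for a
  proof -
    have 1: "x + a *\<^sub>R u + s *\<^sub>R v \<in> S" "x + a *\<^sub>R u \<in> S"
      using sub[OF a, of s] sub[OF a, of 0] s by auto
    have "((\<lambda>a. f (x + a *\<^sub>R u + s *\<^sub>R v)) has_derivative (\<lambda>h. h * ?D (x + a *\<^sub>R u + s *\<^sub>R v) u)) (at a)"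
      by (rule has_derivative_along_line[where p="\<lambda>a. x + a *\<^sub>R u + s *\<^sub>R v" and q="x + s *\<^sub>R v", OF D[OF 1(1)]])
        (simp add: add_ac)
    moreover have "((\<lambda>a. f (x + a *\<^sub>R u)) has_derivative (\<lambda>h. h * ?D (x + a *\<^sub>R u) u)) (at a)"
      by (rule has_derivative_along_line[where p="\<lambda>a. x + a *\<^sub>R u", OF D[OF 1(2)]]) simp
    ultimately show ?thesis unfolding G_def right_diff_distrib by (rule has_derivative_diff)
  qed
  have "\<exists>a\<in>{0<..<s}. G s - G 0 = (s - 0) * (?D (x + a *\<^sub>R u + s *\<^sub>R v) u - ?D (x + a *\<^sub>R u) u)"
    by (rule mvt_simple[OF s, of G "\<lambda>a h. h * (?D (x + a *\<^sub>R u + s *\<^sub>R v) u - ?D (x + a *\<^sub>R u) u)"])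
      (use G in \<open>auto intro: has_derivative_at_withinI\<close>)
  then obtain a where a: "a \<in> {0..s}" "G s - G 0 = s * (?D (x + a *\<^sub>R u + s *\<^sub>R v) u - ?D (x + a *\<^sub>R u) u)"
    by (metis atLeastAtMost_iff diff_zero greaterThanLessThan_iff less_imp_le)
  have H: "((\<lambda>b. ?D (x + a *\<^sub>R u + b *\<^sub>R v) u) has_derivative (\<lambda>h. h * ?E (x + a *\<^sub>R u + b *\<^sub>R v) v)) (at b)"
    if b: "b \<in> {0..s}" for b
    by (rule has_derivative_along_line[where f="\<lambda>y. ?D y u" and
        p="\<lambda>b. x + a *\<^sub>R u + b *\<^sub>R v", OF E[OF sub[OF a(1) b]]]) simp
  have "\<exists>b\<in>{0<..<s}. ?D (x + a *\<^sub>R u + s *\<^sub>R v) u - ?D (x + a *\<^sub>R u + 0 *\<^sub>R v) u = (s - 0) * ?E (x + a *\<^sub>R u + b *\<^sub>R v) v"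
    by (rule mvt_simple[OF s, of "\<lambda>b. ?D (x + a *\<^sub>R u + b *\<^sub>R v) u" "\<lambda>b h. h * ?E (x + a *\<^sub>R u + b *\<^sub>R v) v"])
      (use H in \<open>auto intro: has_derivative_at_withinI\<close>)
  then obtain b where b: "b \<in> {0..s}" "?D (x + a *\<^sub>R u + s *\<^sub>R v) u - ?D (x + a *\<^sub>R u) u = s * ?E (x + a *\<^sub>R u + b *\<^sub>R v) v"
    by (metis (no_types) add.right_neutral atLeastAtMost_iff diff_zero greaterThanLessThan_iff less_imp_le scaleR_zero_left)
  show ?thesis
    by (rule bexI[OF _ a(1)], rule bexI[OF _ b(1)]) (use a(2) b(2) in \<open>simp add: G_def\<close>)
qed

text \<open>The second difference is unchanged when \<open>u\<close> and \<open>v\<close> are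
  exchanged. The two mixed derivatives thus take equal values at two points arbitrarily near
  \<open>x\<close>, and continuity carries this to \<open>x\<close>.\<close>

lemma second_derivative_symmetric:
  fixes f :: "'e::euclidean_space \<Rightarrow> real"
  assumes "open S" "x \<in> S" and C2: "Ck_on 2 S f"
  shows "frechet_derivative (\<lambda>y. frechet_derivative f (at y) u) (at x) v =
         frechet_derivative (\<lambda>y. frechet_derivative f (at y) v) (at x) u" (is "?l x = ?r x")
proof (rule ccontr)
  assume ne: "?l x \<noteq> ?r x"
  \<comment> \<open>Half the gap: values within \<open>e\<close> of the two sides cannot
    coincide.\<close>
  define e where "e = \<bar>?l x - ?r x\<bar> / 2"
  have e: "e > 0" using ne by (simp add: e_def)
  have "continuous_on S ?l" "continuous_on S ?r" using C2 by (auto simp: numeral_2_eq_2)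
  then obtain d1 d2 where d: "d1 > 0" "\<And>y. y \<in> S \<Longrightarrow> dist y x < d1 \<Longrightarrow> dist (?l y) (?l x) < e"
    "d2 > 0" "\<And>y. y \<in> S \<Longrightarrow> dist y x < d2 \<Longrightarrow> dist (?r y) (?r x) < e"
    using assms(2) e unfolding continuous_on_iff by metis
  obtain r where r: "r > 0" "ball x r \<subseteq> S" using assms open_contains_ball by blast
  define m where "m = min r (min d1 d2)"
  \<comment> \<open>With this \<open>s\<close> the whole parallelogram lies within m / 2 of
    \<open>x\<close>; the added 1 keeps the denominator positive when both vectors vanish.\<close>
  define s where "s = m / (2 * (norm u + norm v + 1))"
  have m: "m > 0" using r d by (simp add: m_def)
  have s: "s > 0" unfolding s_def using m by (intro divide_pos_pos) (auto intro: add_nonneg_pos)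
  have near: "dist (x + a *\<^sub>R u + b *\<^sub>R v) x < m" if "a \<in> {0..s}" "b \<in> {0..s}" for a b
  proof -
    have "dist (x + a *\<^sub>R u + b *\<^sub>R v) x \<le> norm (a *\<^sub>R u) + norm (b *\<^sub>R v)"
      by (simp add: dist_norm) (metis norm_scaleR norm_triangle_ineq)
    also have "\<dots> \<le> s * norm u + s * norm v"
      using that by (auto intro!: add_mono mult_right_mono)
    also have "\<dots> \<le> s * (norm u + norm v + 1)" using s by (simp add: algebra_simps)
    also have "\<dots> = m / 2" unfolding s_def
      using add_nonneg_pos[of "norm u + norm v" 1] by (simp add: field_simps)
    finally show ?thesis using m by simp
  qed
  then have sub: "x + a *\<^sub>R u + b *\<^sub>R v \<in> S" if "a \<in> {0..s}" "b \<in> {0..s}" for a b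
    using r(2) that by (force simp: m_def dist_commute)
  have sub': "x + a *\<^sub>R v + b *\<^sub>R u \<in> S" if "a \<in> {0..s}" "b \<in> {0..s}" for a b
    using sub[OF that(2,1)] by (simp add: add_ac)
  obtain a b where ab: "a \<in> {0..s}" "b \<in> {0..s}"
    "f (x + s *\<^sub>R u + s *\<^sub>R v) - f (x + s *\<^sub>R u) - f (x + s *\<^sub>R v) + f x = s * s * ?l (x + a *\<^sub>R u + b *\<^sub>R v)"
    using mixed_difference[OF C2 s sub] by metis
  obtain a' b' where ab': "a' \<in> {0..s}" "b' \<in> {0..s}"
    "f (x + s *\<^sub>R v + s *\<^sub>R u) - f (x + s *\<^sub>R v) - f (x + s *\<^sub>R u) + f x = s * s * ?r (x + a' *\<^sub>R v + b' *\<^sub>R u)"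
    using mixed_difference[OF C2 s sub'] by metis
  have "s * s * ?l (x + a *\<^sub>R u + b *\<^sub>R v) = s * s * ?r (x + a' *\<^sub>R v + b' *\<^sub>R u)"
    unfolding ab(3)[symmetric] ab'(3)[symmetric] by (simp add: add_ac)
  then have eq: "?l (x + a *\<^sub>R u + b *\<^sub>R v) = ?r (x + a' *\<^sub>R v + b' *\<^sub>R u)" using s by simp
  have "dist (?l (x + a *\<^sub>R u + b *\<^sub>R v)) (?l x) < e"
    using near[OF ab(1,2)] sub[OF ab(1,2)] d by (simp add: m_def)
  moreover have "dist (?r (x + a' *\<^sub>R v + b' *\<^sub>R u)) (?r x) < e"
    using near[OF ab'(2,1)] sub'[OF ab'(1,2)] d by (simp add: m_def add_ac)
  ultimately show False using eq e_def unfolding dist_real_def by (smt (verit) field_sum_of_halves)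
qed

section \<open>Cramer's rule and smoothness of inverse functions\<close>

lemma Ck_on_det:
  fixes A :: "'e::euclidean_space \<Rightarrow> real^'n^'n"
  assumes "open S" "\<And>i j. Ck_on k S (\<lambda>x. A x $ i $ j)"
  shows "Ck_on k S (\<lambda>x. det (A x))"
  unfolding det_def by (intro Ck_on_sum Ck_on_mult Ck_on_prod Ck_on_const assms)

text \<open>Cramer's rule writes the coordinates of the solution as quotients of determinants in the
  coefficients, with a denominator that does not vanish.\<close>

lemma Ck_on_cramer:
  fixes A :: "'e::euclidean_space \<Rightarrow> real^'n^'n"
  assumes S: "open S" and A: "\<And>i j. Ck_on k S (\<lambda>x. A x $ i $ j)"
    and nz: "\<And>x. x \<in> S \<Longrightarrow> det (A x) \<noteq> 0"
    and u: "\<And>x. x \<in> S \<Longrightarrow> A x *v u x = v"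
  shows "Ck_on k S u"
proof (rule Ck_on_vec[OF S])
  fix l
  let ?c = "\<lambda>x. det (\<chi> i j. if j = l then v $ i else A x $ i $ j) * inverse (det (A x))"
  have "Ck_on k S (\<lambda>x. (\<chi> i j. if j = l then v $ i else A x $ i $ j) $ i $ j)" for i j
    by (cases "j = l") (simp_all add: Ck_on_const A)
  then have "Ck_on k S ?c"
    by (intro Ck_on_mult Ck_on_inverse Ck_on_det S A nz) auto
  moreover have "?c x = u x $ l" if "x \<in> S" for x
    using cramer[OF nz[OF that], THEN iffD1, OF u[OF that]]
    by (metis (no_types, lifting) divide_inverse vec_lambda_beta)
  ultimately show "Ck_on k S (\<lambda>x. u x $ l)"
    using Ck_on_cong[OF S, of ?c "\<lambda>x. u x $ l"] by blast
qed

text \<open>The inverse function theorem gives a differentiable \<open>g\<close> with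
  \<open>g' y\<close> inverse to the derivative of \<open>f\<close> at \<open>g y\<close>. For fixed
  \<open>v\<close>, \<open>g' y v\<close> solves a linear equation whose matrix is as regular as
  \<open>g\<close>, so Cramer's rule raises the order of \<open>g\<close> by one.\<close>

lemma smooth_inverse_function:
  fixes f :: "real^'n \<Rightarrow> real^'n"
  assumes U: "open U" "smooth_on U f" "x0 \<in> U"
    and id: "\<And>h. frechet_derivative f (at x0) h = h"
  obtains U' V g where "open U'" "U' \<subseteq> U" "x0 \<in> U'" "open V" "homeomorphism U' V f g"
    "smooth_on V g" "\<And>x. x \<in> U' \<Longrightarrow> bij (frechet_derivative f (at x))"
proof -
  let ?D = "\<lambda>x. frechet_derivative f (at x)"
  have der: "(f has_derivative ?D x) (at x)" if "x \<in> U" for x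
    using smooth_on_has_derivative[OF U(2) that] .
  have D: "blinfun_apply (Blinfun (?D x)) = ?D x" if "x \<in> U" for x
    by (rule bounded_linear_Blinfun_apply[OF has_derivative_bounded_linear[OF der[OF that]]])
  have smD: "smooth_on U (\<lambda>x. ?D x v)" for v by (rule smooth_on_frechet[OF U(2)])
  have "continuous_on U (\<lambda>x. Blinfun (?D x) i)" for i
    by (rule continuous_on_cong[THEN iffD1, OF refl _ Ck_on_continuous[of 0]])
      (use smD[of i] in \<open>auto simp: D smooth_on_def simp del: Ck_on.simps\<close>)
  then have cont: "continuous_on U (\<lambda>x. Blinfun (?D x))"
    by (intro continuous_on_blinfun_componentwise)
  \<comment> \<open>The inverse function theorem asks for a left inverse of the derivative at
    \<open>x0\<close>; by the normalisation \<open>id\<close> the identity serves.\<close>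
  have inv0: "id_blinfun o\<^sub>L Blinfun (?D x0) = id_blinfun"
    by (rule blinfun_eqI) (simp add: D[OF U(3)] id)
  obtain U' V g g' where *: "open U'" "U' \<subseteq> U" "x0 \<in> U'" "open V" "homeomorphism U' V f g"
    "\<And>y. y \<in> V \<Longrightarrow> (g has_derivative g' y) (at y)"
    "\<And>y. y \<in> V \<Longrightarrow> g' y = inv (blinfun_apply (Blinfun (?D (g y))))"
    "\<And>y. y \<in> V \<Longrightarrow> bij (blinfun_apply (Blinfun (?D (g y))))"
    by (rule inverse_function_theorem[of U f "\<lambda>x. Blinfun (?D x)" x0 id_blinfun])
      (use U der cont inv0 D in auto)
  have gV: "g y \<in> U'" if "y \<in> V" for y using *(5) that by (auto simp: homeomorphism_def)
  have bij: "bij (?D (g y))" if "y \<in> V" for y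
    using *(8)[OF that] D gV[OF that] *(2) by auto
  let ?A = "\<lambda>y. matrix (?D (g y))"
  have lin: "linear (?D x)" if "x \<in> U" for x
    by (rule bounded_linear.linear[OF has_derivative_bounded_linear[OF der[OF that]]])
  have mat: "matrix (?D x) *v h = ?D x h" if "x \<in> U" for x h
    using matrix_vector_mul(2)[OF lin[OF that]] by metis
  have g': "?A y *v g' y v = v" if "y \<in> V" for y v
  proof -
    have "g y \<in> U" using gV[OF that] *(2) by blast
    then show ?thesis
      using *(7)[OF that] D[of "g y"] bij[OF that] mat[of "g y"]
      by (simp add: bij_is_surj surj_f_inv_f)
  qed
  have nz: "det (?A y) \<noteq> 0" if "y \<in> V" for y
  proof -
    have "g y \<in> U" using gV[OF that] *(2) by blast
    then show ?thesis
      using bij[OF that] lin[of "g y"]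
      by (simp add: bij_is_inj det_nz_iff_inj)
  qed
  have "Ck_on k V g" for k
  proof (induction k)
    case 0
    then show ?case using *(5) by (simp add: homeomorphism_def)
  next
    case (Suc k)
    show ?case
    proof (rule Ck_on_SucI[OF *(4,6)])
      fix v
      have "Ck_on k V (\<lambda>y. ?A y $ i $ j)" for i j
      proof -
        have "Ck_on k U (\<lambda>x. ?D x (axis j 1) $ i)"
          using smD by (intro Ck_on_nth U(1)) (simp add: smooth_on_def)
        then have "Ck_on k V (\<lambda>y. ?D (g y) (axis j 1) $ i)"
          using gV *(2) by (intro Ck_on_compose[OF *(4) U(1) _ Suc]) auto
        then show ?thesis by (simp add: matrix_def)
      qed
      from Ck_on_cramer[OF *(4) this nz g'] show "Ck_on k V (\<lambda>y. g' y v)" by blast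
    qed
  qed
  then have "smooth_on V g" by (simp add: smooth_on_def)
  moreover have "bij (?D x)" if "x \<in> U'" for x
    using bij[of "f x"] *(5) that by (auto simp: homeomorphism_def)
  ultimately show thesis using * that by blast
qed

section \<open>Total linear differential systems\<close>

lemma continuous_on_slice:
  assumes "continuous_on (U \<times> V) (\<lambda>p. f (fst p) (snd p))" "x \<in> U"
  shows "continuous_on V (f x)"
proof -
  have "continuous_on V (\<lambda>t. (x, t))"
    by (intro continuous_on_Pair continuous_on_const continuous_on_id)
  from continuous_on_compose2[OF assms(1) this] assms(2) show ?thesis by auto
qed

text \<open>The Leibniz rule needs a derivative that is continuous as a
  \<open>blinfun\<close>-valued map. In finite dimension this follows from continuity in each fixed
  direction, the form in which \<open>Ck_on\<close> supplies it.\<close>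

lemma integral_param_derivative:
  fixes f :: "'e::euclidean_space \<Rightarrow> real \<Rightarrow> 'f::banach"
  assumes U: "open U" "convex U" and x: "x \<in> U"
    and der: "\<And>x t. x \<in> U \<Longrightarrow> t \<in> {0..1} \<Longrightarrow> ((\<lambda>x. f x t) has_derivative f' x t) (at x)"
    and cont': "\<And>h. continuous_on (U \<times> {0..1}) (\<lambda>p. f' (fst p) (snd p) h)"
    and cont: "\<And>x. x \<in> U \<Longrightarrow> continuous_on {0..1} (f x)"
  shows "((\<lambda>x. integral {0..1} (f x)) has_derivative (\<lambda>h. integral {0..1} (\<lambda>t. f' x t h))) (at x)"
proof -
  define F where "F x t = Blinfun (f' x t)" for x t
  have F: "blinfun_apply (F x t) = f' x t" if "x \<in> U" "t \<in> {0..1}" for x t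
    unfolding F_def by (rule bounded_linear_Blinfun_apply[OF has_derivative_bounded_linear[OF der[OF that]]])
  have contF: "continuous_on (U \<times> {0..1}) (\<lambda>p. F (fst p) (snd p))"
    by (rule continuous_on_blinfun_componentwise, rule continuous_on_cong[THEN iffD1, OF refl _ cont'])
      (auto simp: F)
  have "((\<lambda>x. integral (cbox 0 1) (f x)) has_derivative integral (cbox 0 1) (F x)) (at x within U)"
  proof (rule leibniz_rule[OF _ _ _ x U(2)])
    show "((\<lambda>x. f x t) has_derivative F x t) (at x within U)" if "x \<in> U" "t \<in> cbox 0 1" for x t
      using der[of x t] F[of x t] that by (auto intro: has_derivative_at_withinI)
    show "f x integrable_on cbox 0 1" if "x \<in> U" for x
      using integrable_continuous[of 0 1 "f x"] cont[OF that] by simp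
    show "continuous_on (U \<times> cbox 0 1) (\<lambda>(x, t). F x t)"
      using contF by (simp add: case_prod_beta)
  qed
  moreover have "integral {0..1} (F x) h = integral {0..1} (\<lambda>t. f' x t h)" for h
  proof -
    have "continuous_on {0..1} (F x)" by (rule continuous_on_slice[OF contF x])
    then have "F x integrable_on {0..1}" by (rule integrable_continuous_interval)
    then have "integral {0..1} (F x) h = integral {0..1} (\<lambda>t. F x t h)"
      by (rule blinfun_apply_integral)
    also have "\<dots> = integral {0..1} (\<lambda>t. f' x t h)"
      by (rule integral_cong) (simp add: F x)
    finally show ?thesis .
  qed
  then have "blinfun_apply (integral (cbox 0 1) (F x)) = (\<lambda>h. integral {0..1} (\<lambda>t. f' x t h))"
    by (simp add: fun_eq_iff)
  ultimately show ?thesis using at_within_open[OF x U(1)] by simp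
qed

lemma integral_param_continuous:
  fixes g :: "'e::euclidean_space \<Rightarrow> real \<Rightarrow> 'f::banach"
  assumes "continuous_on (U \<times> {0..1}) (\<lambda>p. g (fst p) (snd p))"
  shows "continuous_on U (\<lambda>x. integral {0..1} (g x))"
  using integral_continuous_on_param[of U 0 1 g] assms by (simp add: case_prod_beta)

text \<open>The system is dw(x) h = \<open>B x h (w x)\<close>. Differentiating its right-hand side
  and inserting the system again prescribes a second derivative of w; \<open>flat\<close> says that
  it is symmetric. The constant 1/4 is chosen so that 2 K \<rho> \<le> 1/2 in
  \<open>T_defect\<close>.\<close>

locale flat_linear_system =
  fixes x0 :: "'e::euclidean_space" and \<rho> K :: real
    and B :: "'e \<Rightarrow> 'e \<Rightarrow>\<^sub>L 'f::banach \<Rightarrow>\<^sub>L 'f"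
  assumes rho: "\<rho> > 0" and K: "K \<ge> 0" "K * \<rho> \<le> 1 / 4"
    and C1: "Ck_on 1 (ball x0 \<rho>) B"
    and bound: "\<And>x. x \<in> ball x0 \<rho> \<Longrightarrow> norm (B x) \<le> K"
    and flat: "\<And>x u v w. x \<in> ball x0 \<rho> \<Longrightarrow>
      frechet_derivative B (at x) u v w + B x v (B x u w) =
      frechet_derivative B (at x) v u w + B x u (B x v w)"
begin

abbreviation U where "U \<equiv> ball x0 \<rho>"
abbreviation B' where "B' x u \<equiv> frechet_derivative B (at x) u"
definition seg where "seg t x = x0 + t *\<^sub>R (x - x0)"

lemma seg_in: "x \<in> U \<Longrightarrow> t \<in> {0..1} \<Longrightarrow> seg t x \<in> U"
proof -
  assume "x \<in> U" "t \<in> {0..1}"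
  have "norm (t *\<^sub>R (x - x0)) \<le> 1 * norm (x - x0)"
    unfolding norm_scaleR using \<open>t \<in> {0..1}\<close> by (intro mult_right_mono) auto
  also have "\<dots> < \<rho>" using \<open>x \<in> U\<close> by (simp add: dist_norm norm_minus_commute)
  finally show ?thesis by (simp add: seg_def dist_norm)
qed

lemma seg_1: "seg 1 x = x" by (simp add: seg_def)

lemma B_der: "x \<in> U \<Longrightarrow> (B has_derivative B' x) (at x)"
  using Ck_on_has_derivative[of 0 U B] C1 by (simp only: One_nat_def)

lemma B'_scale: "x \<in> U \<Longrightarrow> B' x (t *\<^sub>R h) = t *\<^sub>R B' x h"
  using linear_simps(5)[OF has_derivative_bounded_linear[OF B_der]] by blast

lemma contB: "continuous_on U B" using C1 by (rule Ck_on_continuous)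
lemma contB': "continuous_on U (\<lambda>x. B' x h)" using C1 by (auto simp: One_nat_def)

lemma norm_B: "x \<in> U \<Longrightarrow> norm (B x u w) \<le> K * norm u * norm w"
  by (rule order_trans[OF norm_blinfun mult_right_mono[OF order_trans[OF norm_blinfun mult_right_mono[OF bound]]]]) auto

text \<open>The Picard operator of the ordinary differential equations that a solution obeys along
  the segments from \<open>x0\<close>, for all end points at once. Parametrising every segment by
  {0..1} keeps \<open>x\<close> out of the limits of integration.\<close>

definition T where
  "T w0 w x = w0 + integral {0..1} (\<lambda>t. B (seg t x) (x - x0) (w (seg t x)))"

text \<open>The derivative at \<open>x\<close>, in direction \<open>h\<close>, of the integrand of
  \<open>T\<close>; the factors t come from the derivative of \<open>seg t\<close>.\<close>

definition integrand' where
  "integrand' w x t h = B (seg t x) (x - x0) (t *\<^sub>R frechet_derivative w (at (seg t x)) h) +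
     (B (seg t x) h + t *\<^sub>R B' (seg t x) h (x - x0)) (w (seg t x))"

context
  fixes w :: "'e \<Rightarrow> 'f"
  assumes wC1: "Ck_on 1 U w"
begin

abbreviation w' where "w' x h \<equiv> frechet_derivative w (at x) h"

lemma w_der: "x \<in> U \<Longrightarrow> (w has_derivative w' x) (at x)"
  using Ck_on_has_derivative[of 0 U w] wC1 by (simp only: One_nat_def)

lemma contw: "continuous_on U w" using wC1 by (rule Ck_on_continuous)
lemma contw': "continuous_on U (\<lambda>x. w' x h)" using wC1 by (auto simp: One_nat_def)

lemma cont_seg: "continuous_on (U \<times> {0..1}) (\<lambda>p. seg (snd p) (fst p))"
  unfolding seg_def by (intro continuous_intros)

lemma cont_comp_seg:
  "continuous_on U f \<Longrightarrow> continuous_on (U \<times> {0..1}) (\<lambda>p. f (seg (snd p) (fst p)))"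
  by (rule continuous_on_compose2[OF _ cont_seg]) (auto intro: seg_in)

lemma cont_integrand:
  "continuous_on (U \<times> {0..1}) (\<lambda>p. B (seg (snd p) (fst p)) (fst p - x0) (w (seg (snd p) (fst p))))"
  by (intro continuous_intros cont_comp_seg contB contw)

lemma cont_integrand':
  "continuous_on (U \<times> {0..1}) (\<lambda>p. integrand' w (fst p) (snd p) h)"
  unfolding integrand'_def
  by (intro continuous_intros cont_comp_seg contB contw contB' contw')

lemma der_integrand:
  assumes x: "x \<in> U" and t: "t \<in> {0..1}"
  shows "((\<lambda>x. B (seg t x) (x - x0) (w (seg t x))) has_derivative integrand' w x t) (at x)"
proof -
  have s: "(seg t has_derivative (\<lambda>h. t *\<^sub>R h)) (at x)"
    unfolding seg_def[abs_def] by (auto intro!: derivative_eq_intros)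
  note m = seg_in[OF x t]
  have d1: "((\<lambda>x. B (seg t x)) has_derivative (\<lambda>h. t *\<^sub>R B' (seg t x) h)) (at x)"
    using has_derivative_compose[OF s B_der[OF m]] B'_scale[OF m] by simp
  have d2: "((\<lambda>x. w (seg t x)) has_derivative (\<lambda>h. t *\<^sub>R w' (seg t x) h)) (at x)"
    using has_derivative_compose[OF s w_der[OF m]]
      linear_simps(5)[OF has_derivative_bounded_linear[OF w_der[OF m]]] by simp
  have d3: "((\<lambda>x. x - x0) has_derivative (\<lambda>h. h)) (at x)" by (auto intro!: derivative_eq_intros)
  note bil = bounded_bilinear.FDERIV[OF bounded_bilinear_blinfun_apply]
  from bil[OF bil[OF d1 d3] d2] show ?thesis
    unfolding integrand'_def[abs_def] by (simp add: blinfun.scaleR_left blinfun.add_left)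
qed

lemma T_der:
  "x \<in> U \<Longrightarrow> (T w0 w has_derivative (\<lambda>h. integral {0..1} (\<lambda>t. integrand' w x t h))) (at x)"
proof -
  assume x: "x \<in> U"
  have "((\<lambda>x. integral {0..1} (\<lambda>t. B (seg t x) (x - x0) (w (seg t x)))) has_derivative
     (\<lambda>h. integral {0..1} (\<lambda>t. integrand' w x t h))) (at x)"
    by (rule integral_param_derivative[OF open_ball convex_ball x der_integrand cont_integrand'])
      (use continuous_on_slice[OF cont_integrand] in auto)
  then show ?thesis unfolding T_def[abs_def] by (auto intro!: derivative_eq_intros)
qed

text \<open>The iteration stays within C^1 functions; higher regularity is recovered afterwards from
  the equation, in \<open>linear_system_smooth\<close>.\<close>

lemma T_C1: "Ck_on 1 U (T w0 w)"
  unfolding One_nat_def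
  by (rule Ck_on_SucI[OF open_ball T_der]) (auto intro: integral_param_continuous cont_integrand')

text \<open>By flatness the derivative of \<open>t B(x\<^sub>t) h (w x\<^sub>t)\<close> along the segment \<open>x\<^sub>t\<close> from \<open>x0\<close> to \<open>x\<close>
  differs from the \<open>h\<close>-derivative of the integrand of \<open>T\<close> only by terms linear in the defect
  \<open>w' - B w\<close>.\<close>

lemma integrand'_eq:
  assumes x: "x \<in> U" and t: "t \<in> {0..1}"
  defines "y \<equiv> seg t x" and "v \<equiv> x - x0"
  shows "integrand' w x t h =
    (B y h (w y) + t *\<^sub>R (B' y v h (w y) + B y h (w' y v))) +
    t *\<^sub>R (B y v (w' y h - B y h (w y)) - B y h (w' y v - B y v (w y)))"
proof -
  have y: "y \<in> U" unfolding y_def by (rule seg_in[OF x t])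
  have f: "B' y h v (w y) = B' y v h (w y) + B y h (B y v (w y)) - B y v (B y h (w y))"
    using flat[OF y, of h v "w y"] by (simp add: algebra_simps)
  show ?thesis unfolding integrand'_def y_def[symmetric] v_def[symmetric]
    by (simp add: blinfun.add_left blinfun.scaleR_left blinfun.scaleR_right blinfun.diff_right f
        scaleR_add_right scaleR_diff_right)
qed

text \<open>Integration by parts along the segment: \<open>?G\<close> is the derivative of t times
  \<open>B(x_t) h (w x_t)\<close>, with boundary values \<open>B x h (w x)\<close> and 0. What
  remains, \<open>?I\<close>, is linear in the defect of \<open>w\<close>. The new defect is
  measured against the old \<open>w\<close>, not against \<open>T w0 w\<close>.\<close>

lemma T_defect:
  assumes x: "x \<in> U"
    and e: "\<And>x h. x \<in> U \<Longrightarrow> norm (w' x h - B x h (w x)) \<le> e * norm h" and e0: "e \<ge> 0"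
  shows "norm (frechet_derivative (T w0 w) (at x) h - B x h (w x)) \<le> e / 2 * norm h"
proof -
  let ?y = "\<lambda>t. seg t x" and ?v = "x - x0"
  let ?G = "\<lambda>t. B (?y t) h (w (?y t)) + t *\<^sub>R (B' (?y t) ?v h (w (?y t)) + B (?y t) h (w' (?y t) ?v))"
  let ?I = "\<lambda>t. t *\<^sub>R (B (?y t) ?v (w' (?y t) h - B (?y t) h (w (?y t))) - B (?y t) h (w' (?y t) ?v - B (?y t) ?v (w (?y t))))"
  have G: "(?G has_integral (1 *\<^sub>R B (?y 1) h (w (?y 1)) - 0 *\<^sub>R B (?y 0) h (w (?y 0)))) {0..1}"
  proof (rule fundamental_theorem_of_calculus)
    fix t :: real assume t: "t \<in> {0..1}"
    note m = seg_in[OF x t]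
    have s: "((\<lambda>t. seg t x) has_derivative (\<lambda>a. a *\<^sub>R ?v)) (at t)"
      unfolding seg_def[abs_def] by (auto intro!: derivative_eq_intros)
    have d1: "((\<lambda>t. B (?y t)) has_derivative (\<lambda>a. a *\<^sub>R B' (?y t) ?v)) (at t)"
      using has_derivative_compose[OF s B_der[OF m]] B'_scale[OF m] by simp
    have d2: "((\<lambda>t. w (?y t)) has_derivative (\<lambda>a. a *\<^sub>R w' (?y t) ?v)) (at t)"
      using has_derivative_compose[OF s w_der[OF m]]
        linear_simps(5)[OF has_derivative_bounded_linear[OF w_der[OF m]]] by simp
    note bil = bounded_bilinear.FDERIV[OF bounded_bilinear_blinfun_apply]
    have "((\<lambda>t. t *\<^sub>R B (?y t) h (w (?y t))) has_derivative (\<lambda>a. a *\<^sub>R ?G t)) (at t)"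
      by (rule has_derivative_eq_rhs[OF bounded_bilinear.FDERIV[OF bounded_bilinear_scaleR has_derivative_ident
          bil[OF bil[OF d1 has_derivative_const] d2]]])
        (auto simp: fun_eq_iff blinfun.scaleR_left blinfun.scaleR_right blinfun.add_left blinfun.zero_right
          algebra_simps)
    then show "((\<lambda>t. t *\<^sub>R B (?y t) h (w (?y t))) has_vector_derivative ?G t) (at t within {0..1})"
      unfolding has_vector_derivative_def by (rule has_derivative_at_withinI)
  qed simp
  \<comment> \<open>One direction is frozen as \<open>?v\<close>, because continuity of
    \<open>w'\<close> is known for fixed directions only; at the given \<open>x\<close> this agrees
    with \<open>?I\<close>.\<close>
  let ?J = "\<lambda>x t. t *\<^sub>R (B (seg t x) (x - x0) (w' (seg t x) h - B (seg t x) h (w (seg t x))) -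
      B (seg t x) h (w' (seg t x) ?v - B (seg t x) ?v (w (seg t x))))"
  have "continuous_on (U \<times> {0..1}) (\<lambda>p. ?J (fst p) (snd p))"
    by (intro continuous_intros cont_comp_seg contB contw contw')
  then have contI: "continuous_on {0..1} ?I"
    by (rule continuous_on_slice[where f="?J", OF _ x])
  have "norm (integral {0..1} ?I) \<le> e / 2 * norm h * (1 - 0)"
  proof (rule integral_bound[OF _ contI])
    fix t :: real assume t: "t \<in> {0..1}"
    note m = seg_in[OF x t]
    have v: "norm ?v \<le> \<rho>" using x by (simp add: dist_norm norm_minus_commute)
    let ?a = "B (?y t) ?v (w' (?y t) h - B (?y t) h (w (?y t)))"
    let ?b = "B (?y t) h (w' (?y t) ?v - B (?y t) ?v (w (?y t)))"
    have a: "norm ?a \<le> K * norm ?v * (e * norm h)"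
      by (rule order_trans[OF norm_B[OF m] mult_left_mono[OF e[OF m]]]) (use K in auto)
    have b: "norm ?b \<le> K * norm h * (e * norm ?v)"
      by (rule order_trans[OF norm_B[OF m] mult_left_mono[OF e[OF m]]]) (use K in auto)
    have "norm (t *\<^sub>R (?a - ?b)) \<le> 1 * norm (?a - ?b)"
      unfolding norm_scaleR using t by (intro mult_right_mono) auto
    also have "\<dots> \<le> 2 * (K * norm ?v * (e * norm h))"
      using norm_triangle_ineq4[of ?a ?b] a b by (simp add: algebra_simps)
    also have "\<dots> \<le> 2 * (K * \<rho> * (e * norm h))"
      using v K e0 by (intro mult_left_mono mult_right_mono) auto
    \<comment> \<open>Two terms, each at most K \<rho> times the old bound: with K \<rho> \<le> 1/4
      the bound is halved.\<close>
    also have "\<dots> \<le> 2 * (1/4 * (e * norm h))"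
      using K e0 by (intro mult_left_mono mult_right_mono) auto
    finally show "norm (t *\<^sub>R (?a - ?b)) \<le> e / 2 * norm h" by simp
  qed simp
  moreover have "integral {0..1} (\<lambda>t. integrand' w x t h) = B x h (w x) + integral {0..1} ?I"
  proof -
    have "integral {0..1} (\<lambda>t. integrand' w x t h) = integral {0..1} (\<lambda>t. ?G t + ?I t)"
      by (rule integral_cong) (rule integrand'_eq[OF x])
    also have "\<dots> = integral {0..1} ?G + integral {0..1} ?I"
      by (rule integral_add) (use G contI integrable_continuous_interval in auto)
    also have "integral {0..1} ?G = B x h (w x)" using integral_unique[OF G] by (simp add: seg_1)
    finally show ?thesis .
  qed
  ultimately show ?thesis using frechet_derivative_at[OF T_der[OF x]] by simp
qed

end

primrec iter where
  "iter w0 0 = (\<lambda>x. w0)"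
| "iter w0 (Suc m) = T w0 (iter w0 m)"

lemma iter_C1: "Ck_on 1 U (iter w0 m)"
  by (induction m) (auto intro: Ck_on_const T_C1 simp del: One_nat_def)

text \<open>The constant \<open>w0\<close> cancels in the difference of two values of
  \<open>T\<close>, so the previous difference is integrated against \<open>B\<close> and gains a
  factor K \<rho>. It is estimated by 1/2, the rate at which the defect shrinks.\<close>

lemma iter_diff:
  assumes x: "x \<in> U"
  shows "norm (iter w0 (Suc m) x - iter w0 m x) \<le> norm w0 / 2 ^ m"
  using x
proof (induction m arbitrary: x)
  case 0
  have "norm (integral {0..1} (\<lambda>t. B (seg t x) (x - x0) w0)) \<le> norm w0 * (1 - 0)"
  proof (rule integral_bound)
    show "continuous_on {0..1} (\<lambda>t. B (seg t x) (x - x0) w0)"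
      by (rule continuous_on_slice[OF _ 0, where f="\<lambda>x t. B (seg t x) (x - x0) w0"])
        (use cont_integrand[OF Ck_on_const] in auto)
    fix t :: real assume t: "t \<in> {0..1}"
    have "norm (B (seg t x) (x - x0) w0) \<le> K * norm (x - x0) * norm w0"
      by (rule norm_B[OF seg_in[OF 0 t]])
    also have "\<dots> \<le> K * \<rho> * norm w0"
      using 0 K by (intro mult_right_mono mult_left_mono) (auto simp: dist_norm norm_minus_commute)
    also have "\<dots> \<le> 1 * norm w0"
      using K by (intro mult_right_mono) auto
    finally show "norm (B (seg t x) (x - x0) w0) \<le> norm w0" by simp
  qed simp
  then show ?case by (simp add: T_def)
next
  case (Suc m)
  let ?f = "\<lambda>m t. B (seg t x) (x - x0) (iter w0 m (seg t x))"
  have c: "continuous_on {0..1} (?f m)" for m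
    by (rule continuous_on_slice[OF _ Suc.prems, where f="\<lambda>x t. B (seg t x) (x - x0) (iter w0 m (seg t x))"])
      (rule cont_integrand[OF iter_C1])
  have "norm (integral {0..1} (\<lambda>t. ?f (Suc m) t - ?f m t)) \<le> norm w0 / 2 ^ Suc m * (1 - 0)"
  proof (rule integral_bound)
    show "continuous_on {0..1} (\<lambda>t. ?f (Suc m) t - ?f m t)" by (intro continuous_on_diff c)
    fix t :: real assume t: "t \<in> {0..1}"
    note s = seg_in[OF Suc.prems t]
    have "?f (Suc m) t - ?f m t = B (seg t x) (x - x0) (iter w0 (Suc m) (seg t x) - iter w0 m (seg t x))"
      by (simp only: blinfun.diff_right)
    then have "norm (?f (Suc m) t - ?f m t) \<le>
        K * norm (x - x0) * norm (iter w0 (Suc m) (seg t x) - iter w0 m (seg t x))"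
      using norm_B[OF s] by metis
    also have "\<dots> \<le> K * norm (x - x0) * (norm w0 / 2 ^ m)"
      using K by (intro mult_left_mono Suc.IH s) auto
    also have "\<dots> \<le> K * \<rho> * (norm w0 / 2 ^ m)"
      using Suc.prems K by (intro mult_right_mono mult_left_mono) (auto simp: dist_norm norm_minus_commute)
    also have "\<dots> \<le> 1 / 2 * (norm w0 / 2 ^ m)"
      using K by (intro mult_right_mono) auto
    finally show "norm (?f (Suc m) t - ?f m t) \<le> norm w0 / 2 ^ Suc m" by simp
  qed simp
  moreover have "integral {0..1} (\<lambda>t. ?f (Suc m) t - ?f m t) = integral {0..1} (?f (Suc m)) - integral {0..1} (?f m)"
    by (intro integral_diff integrable_continuous_interval c)
  ultimately show ?case by (simp only: iter.simps(2)[of _ "Suc m"]) (simp add: T_def)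
qed

text \<open>The defect obeys d(m+1) \<le> d(m) / 2 + K \<open>norm w0\<close> / 2^m: the first term
  is \<open>T_defect\<close>, the second pays for replacing the old iterate by the new one under
  \<open>B x h\<close>. As both rates are 1/2, the solution of the recursion carries the factor m +
  1.\<close>

lemma iter_defect:
  assumes x: "x \<in> U"
  shows "norm (frechet_derivative (iter w0 m) (at x) h - B x h (iter w0 m x))
    \<le> 2 * K * norm w0 * (real m + 1) / 2 ^ m * norm h"
  using x
proof (induction m arbitrary: x h)
  case 0
  have "norm (B x h w0) \<le> K * norm h * norm w0" by (rule norm_B[OF 0])
  also have "\<dots> \<le> 2 * (K * norm h * norm w0)" using K by simp
  finally show ?case by (simp add: mult_ac)
next
  case (Suc m)
  let ?c = "norm w0 / 2 ^ m"
  have 1: "norm (frechet_derivative (iter w0 (Suc m)) (at x) h - B x h (iter w0 m x))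
     \<le> 2 * K * norm w0 * (real m + 1) / 2 ^ m / 2 * norm h"
    unfolding iter.simps by (rule T_defect[OF iter_C1 Suc.prems Suc.IH]) (use K in auto)
  have "norm (B x h (iter w0 (Suc m) x - iter w0 m x)) \<le> K * norm h * norm (iter w0 (Suc m) x - iter w0 m x)"
    by (rule norm_B[OF Suc.prems])
  also have "\<dots> \<le> K * norm h * ?c" using K by (intro mult_left_mono iter_diff Suc.prems) auto
  finally have 2: "norm (B x h (iter w0 (Suc m) x) - B x h (iter w0 m x)) \<le> K * norm h * ?c"
    by (simp only: blinfun.diff_right)
  have "norm (frechet_derivative (iter w0 (Suc m)) (at x) h - B x h (iter w0 (Suc m) x))
     \<le> 2 * K * norm w0 * (real m + 1) / 2 ^ m / 2 * norm h + K * norm h * ?c"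
    using norm_triangle_ineq4[of "frechet_derivative (iter w0 (Suc m)) (at x) h - B x h (iter w0 m x)"
        "B x h (iter w0 (Suc m) x) - B x h (iter w0 m x)"] 1 2 by simp
  also have "\<dots> = 2 * K * norm w0 * (real (Suc m) + 1) / 2 ^ Suc m * norm h"
    by (simp add: field_simps)
  finally show ?case .
qed

lemma iter_tail:
  assumes x: "x \<in> U"
  shows "norm (iter w0 (m + k) x - iter w0 m x) \<le> 2 * norm w0 / 2 ^ m"
proof -
  \<comment> \<open>The deficit 1 / 2^k of the partial geometric sum makes the induction close; it
    is dropped at the end.\<close>
  have "norm (iter w0 (m + k) x - iter w0 m x) \<le> 2 * norm w0 / 2 ^ m * (1 - 1 / 2 ^ k)"
  proof (induction k)
    case (Suc k)
    have "norm (iter w0 (m + Suc k) x - iter w0 m x) \<le>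
        norm (iter w0 (m + k) x - iter w0 m x) + norm (iter w0 (Suc (m + k)) x - iter w0 (m + k) x)"
      using norm_triangle_ineq[of "iter w0 (m + k) x - iter w0 m x"
          "iter w0 (Suc (m + k)) x - iter w0 (m + k) x"] by (simp del: iter.simps)
    also have "\<dots> \<le> 2 * norm w0 / 2 ^ m * (1 - 1 / 2 ^ k) + norm w0 / 2 ^ (m + k)"
      by (intro add_mono Suc iter_diff x)
    also have "\<dots> = 2 * norm w0 / 2 ^ m * (1 - 1 / 2 ^ Suc k)"
      by (simp add: field_simps power_add)
    finally show ?case .
  qed simp
  also have "\<dots> \<le> 2 * norm w0 / 2 ^ m * 1" by (intro mult_left_mono) auto
  finally show ?thesis by simp
qed

text \<open>The derivatives of the iterates converge uniformly to \<open>B x h (l x)\<close>,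
  because the defect tends to 0 and the iterates tend uniformly to \<open>l\<close>. Termwise
  differentiation of the sequence then shows that the limit solves the system.\<close>

lemma solution_exists: "\<exists>w. w x0 = w0 \<and> (\<forall>x\<in>U. (w has_derivative (\<lambda>h. B x h (w x))) (at x))"
proof -
  let ?c = "norm w0"
  have half: "(\<lambda>m. (1/2::real) ^ m) \<longlonglongrightarrow> 0" by (rule LIMSEQ_power_zero) simp
  have nhalf: "(\<lambda>m. real m * (1/2::real) ^ m) \<longlonglongrightarrow> 0" by (rule powser_times_n_limit_0) simp
  have conv: "convergent (\<lambda>m. iter w0 m x)" if x: "x \<in> U" for x
  proof (rule Cauchy_convergent, rule CauchyI)
    fix e :: real assume e: "e > 0"
    have "(\<lambda>m. 4 * ?c * (1/2) ^ m) \<longlonglongrightarrow> 4 * ?c * 0" by (intro tendsto_intros half)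
    then have "\<forall>\<^sub>F m in sequentially. 4 * ?c * (1/2) ^ m < e"
      using e by (intro order_tendstoD(2)) auto
    then obtain M where M: "4 * ?c * (1/2) ^ M < e" by (auto simp: eventually_sequentially)
    show "\<exists>M. \<forall>m\<ge>M. \<forall>n\<ge>M. norm (iter w0 m x - iter w0 n x) < e"
    proof (intro exI allI impI)
      fix m n assume "M \<le> m" "M \<le> n"
      then have "norm (iter w0 m x - iter w0 M x) \<le> 2 * ?c / 2 ^ M"
        "norm (iter w0 n x - iter w0 M x) \<le> 2 * ?c / 2 ^ M"
        using iter_tail[OF x, of w0 M "m - M"] iter_tail[OF x, of w0 M "n - M"] by auto
      then have "norm (iter w0 m x - iter w0 n x) \<le> 4 * ?c / 2 ^ M"
        using norm_triangle_ineq4[of "iter w0 m x - iter w0 M x" "iter w0 n x - iter w0 M x"] by simp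
      with M show "norm (iter w0 m x - iter w0 n x) < e" by (simp add: power_divide)
    qed
  qed
  define l where "l x = lim (\<lambda>m. iter w0 m x)" for x
  have lim: "(\<lambda>m. iter w0 m x) \<longlonglongrightarrow> l x" if "x \<in> U" for x
    using conv[OF that] unfolding l_def by (simp add: convergent_LIMSEQ_iff)
  have tail: "norm (l x - iter w0 m x) \<le> 2 * ?c / 2 ^ m" if x: "x \<in> U" for x m
  proof (rule tendsto_upperbound)
    show "(\<lambda>k. norm (iter w0 (k + m) x - iter w0 m x)) \<longlonglongrightarrow> norm (l x - iter w0 m x)"
      by (intro tendsto_intros LIMSEQ_ignore_initial_segment lim x)
    show "\<forall>\<^sub>F k in sequentially. norm (iter w0 (k + m) x - iter w0 m x) \<le> 2 * ?c / 2 ^ m"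
      using iter_tail[OF x, of w0 m] by (simp add: add.commute)
  qed simp
  have x0: "x0 \<in> U" using rho by simp
  have "\<exists>g. \<forall>x\<in>U. (\<lambda>m. iter w0 m x) \<longlonglongrightarrow> g x \<and> (g has_derivative (\<lambda>h. B x h (l x))) (at x within U)"
  proof (rule has_derivative_sequence[where f="iter w0" and f'="\<lambda>m x. frechet_derivative (iter w0 m) (at x)" and l="l x0",
        OF convex_ball _ _ x0])
    show "(\<lambda>m. iter w0 m x0) \<longlonglongrightarrow> l x0" by (rule lim[OF x0])
    show "(iter w0 m has_derivative frechet_derivative (iter w0 m) (at x)) (at x within U)" if "x \<in> U" for m x
      using w_der[OF iter_C1 that] by (rule has_derivative_at_withinI)
    fix e :: real assume e: "e > 0"
    \<comment> \<open>The defect contributes 2 K \<open>?c\<close> (m + 1) / 2^m, and the distance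
      of the iterate from \<open>l\<close> another 2 K \<open>?c\<close> / 2^m; the parts without
      the factor m add up to 4 K \<open>?c\<close> / 2^m.\<close>
    have "(\<lambda>m. 2 * K * ?c * (real m * (1/2) ^ m) + 4 * K * ?c * (1/2) ^ m) \<longlonglongrightarrow>
       2 * K * ?c * 0 + 4 * K * ?c * 0" by (intro tendsto_intros half nhalf)
    then have "\<forall>\<^sub>F m in sequentially. 2 * K * ?c * (real m * (1/2) ^ m) + 4 * K * ?c * (1/2) ^ m < e"
      using e by (intro order_tendstoD(2)) auto
    then show "\<forall>\<^sub>F m in sequentially. \<forall>x\<in>U. \<forall>h.
        norm (frechet_derivative (iter w0 m) (at x) h - B x h (l x)) \<le> e * norm h"
    proof (rule eventually_mono, intro ballI allI)
      fix m x h assume m: "2 * K * ?c * (real m * (1/2) ^ m) + 4 * K * ?c * (1/2) ^ m < e" and x: "x \<in> U"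
      have "norm (B x h (iter w0 m x - l x)) \<le> K * norm h * norm (iter w0 m x - l x)" by (rule norm_B[OF x])
      also have "\<dots> \<le> K * norm h * (2 * ?c / 2 ^ m)"
        using tail[OF x, of m] K by (intro mult_left_mono) (auto simp: norm_minus_commute)
      finally have "norm (B x h (iter w0 m x) - B x h (l x)) \<le> K * norm h * (2 * ?c / 2 ^ m)"
        by (simp only: blinfun.diff_right)
      then have "norm (frechet_derivative (iter w0 m) (at x) h - B x h (l x))
          \<le> 2 * K * ?c * (real m + 1) / 2 ^ m * norm h + K * norm h * (2 * ?c / 2 ^ m)"
        using norm_triangle_ineq[of "frechet_derivative (iter w0 m) (at x) h - B x h (iter w0 m x)"
            "B x h (iter w0 m x) - B x h (l x)"] iter_defect[OF x, of w0 m h] by simp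
      also have "\<dots> = (2 * K * ?c * (real m * (1/2) ^ m) + 4 * K * ?c * (1/2) ^ m) * norm h"
        by (simp add: field_simps power_divide)
      also have "\<dots> \<le> e * norm h" using m by (intro mult_right_mono) auto
      finally show "norm (frechet_derivative (iter w0 m) (at x) h - B x h (l x)) \<le> e * norm h" .
    qed
  qed
  then obtain g where g: "\<And>x. x \<in> U \<Longrightarrow> (\<lambda>m. iter w0 m x) \<longlonglongrightarrow> g x"
    "\<And>x. x \<in> U \<Longrightarrow> (g has_derivative (\<lambda>h. B x h (l x))) (at x within U)" by blast
  have gl: "g x = l x" if "x \<in> U" for x using LIMSEQ_unique[OF g(1) lim] that by blast
  \<comment> \<open>At \<open>x0\<close> the segment degenerates to a point and the integrand
    vanishes.\<close>
  have "iter w0 m x0 = w0" for m by (cases m) (simp_all add: T_def blinfun.zero_left)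
  then have "g x0 = w0" using LIMSEQ_unique[OF g(1)[OF x0]] by simp
  moreover have "(g has_derivative (\<lambda>h. B x h (g x))) (at x)" if "x \<in> U" for x
    using g(2)[OF that] gl[OF that] at_within_open[OF that open_ball] by simp
  ultimately show ?thesis by blast
qed

end

text \<open>Bootstrapping: the equation expresses each directional derivative of \<open>w\<close>
  through \<open>B\<close> and \<open>w\<close>, so every order gained for \<open>w\<close> passes
  to its derivative.\<close>

lemma linear_system_smooth:
  assumes "open V" "smooth_on V B"
    and der: "\<And>x. x \<in> V \<Longrightarrow> (w has_derivative (\<lambda>h. blinfun_apply (blinfun_apply (B x) h) (w x))) (at x)"
  shows "smooth_on V w"
proof -
  have "Ck_on k V w" for k
  proof (induction k)
    case 0
    then show ?case using der
      by (auto intro!: continuous_at_imp_continuous_on dest: has_derivative_continuous)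
  next
    case (Suc k)
    have "Ck_on k V B" using assms(2) by (simp add: smooth_on_def)
    with Suc have "Ck_on k V (\<lambda>x. B x v (w x))" for v
      by (intro Ck_on_bilinear[OF \<open>open V\<close> bounded_bilinear_blinfun_apply] Ck_on_const)
    then show ?case by (intro Ck_on_SucI[OF \<open>open V\<close> der])
  qed
  then show ?thesis by (simp add: smooth_on_def)
qed

text \<open>By linearity the radius depends on \<open>B\<close> and \<open>V\<close> but not on the
  initial value; the solutions that serve as coordinates therefore share one ball.\<close>

theorem flat_linear_system_solution:
  fixes B :: "'e::euclidean_space \<Rightarrow> 'e \<Rightarrow>\<^sub>L 'f::banach \<Rightarrow>\<^sub>L 'f"
  assumes "open V" "x0 \<in> V" and sm: "smooth_on V B"
    and flat: "\<And>x u v w. x \<in> V \<Longrightarrow>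
      frechet_derivative B (at x) u v w + B x v (B x u w) =
      frechet_derivative B (at x) v u w + B x u (B x v w)"
  shows "\<exists>\<rho>>0. ball x0 \<rho> \<subseteq> V \<and> (\<forall>w0. \<exists>w. w x0 = w0 \<and> smooth_on (ball x0 \<rho>) w \<and>
      (\<forall>x\<in>ball x0 \<rho>. (w has_derivative (\<lambda>h. B x h (w x))) (at x)))"
proof -
  have C: "Ck_on k V B" for k using sm by (simp add: smooth_on_def)
  \<comment> \<open>\<open>K\<close> bounds the norm of \<open>B\<close> wherever \<open>B\<close>
    stays within 1 of its value at \<open>x0\<close>.\<close>
  define K where "K = norm (B x0) + 1"
  have K: "K > 0" by (simp add: K_def add_nonneg_pos)
  obtain d where d: "d > 0" "\<And>y. y \<in> V \<Longrightarrow> dist y x0 < d \<Longrightarrow> dist (B y) (B x0) < 1"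
    using Ck_on_continuous[OF C] \<open>x0 \<in> V\<close> unfolding continuous_on_iff by (metis zero_less_one)
  obtain r where r: "r > 0" "ball x0 r \<subseteq> V" using assms open_contains_ball by blast
  define \<rho> where "\<rho> = min (min d r) (1 / (4 * K))"
  have rho: "\<rho> > 0" using d r K by (simp add: \<rho>_def)
  have sub: "ball x0 \<rho> \<subseteq> V" using r by (auto simp: \<rho>_def)
  have "flat_linear_system x0 \<rho> K B"
  proof
    have "K * \<rho> \<le> K * (1 / (4 * K))" using K by (intro mult_left_mono) (auto simp: \<rho>_def)
    then show "K * \<rho> \<le> 1 / 4" using K by simp
    show "Ck_on 1 (ball x0 \<rho>) B" by (rule Ck_on_mono[OF sub C])
    fix x assume x: "x \<in> ball x0 \<rho>"
    have "dist (B x) (B x0) < 1"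
      using d(2)[of x] sub x by (auto simp: \<rho>_def dist_commute)
    then show "norm (B x) \<le> K"
      unfolding K_def dist_norm using norm_triangle_sub[of "B x" "B x0"] by simp
    show "frechet_derivative B (at x) u v w + B x v (B x u w) =
      frechet_derivative B (at x) v u w + B x u (B x v w)" for u v w
      using flat sub x by blast
  qed (use rho K in auto)
  then have "\<exists>w. w x0 = w0 \<and> smooth_on (ball x0 \<rho>) w \<and>
      (\<forall>x\<in>ball x0 \<rho>. (w has_derivative (\<lambda>h. B x h (w x))) (at x))" for w0
    using flat_linear_system.solution_exists[of x0 \<rho> K B w0]
      linear_system_smooth[OF open_ball smooth_on_mono[OF sub sm]] by meson
  with rho sub show ?thesis by blast
qed

section \<open>The linear system for flat coordinates\<close>

definition blinfun2 :: "('e::euclidean_space \<Rightarrow> 'f::euclidean_space \<Rightarrow> 'g::real_normed_vector) \<Rightarrow> 'e \<Rightarrow>\<^sub>L 'f \<Rightarrow>\<^sub>L 'g" where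
  "blinfun2 b = Blinfun (\<lambda>h. Blinfun (b h))"

text \<open>\<open>Blinfun\<close> is meaningful on bounded linear maps only; in finite dimension
  bilinearity supplies boundedness in both arguments.\<close>

lemma blinfun2_apply: 
  assumes "bilinear b"
  shows "blinfun_apply (blinfun_apply (blinfun2 b) h) w = b h w"
proof -
  interpret bounded_bilinear b using assms by (simp add: bilinear_conv_bounded_bilinear)
  have 1: "blinfun_apply (Blinfun (b h)) = b h" for h
    by (rule bounded_linear_Blinfun_apply[OF bounded_linear_right])
  have "linear (\<lambda>h. Blinfun (b h))"
    by (rule linearI) (auto intro!: blinfun_eqI simp: 1 blinfun.add_left blinfun.scaleR_left add_left scaleR_left)
  then have "blinfun_apply (blinfun2 b) = (\<lambda>h. Blinfun (b h))"
    unfolding blinfun2_def by (intro bounded_linear_Blinfun_apply) (simp add: linear_conv_bounded_linear)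
  then show ?thesis by (simp add: 1)
qed

text \<open>The system \<open>\<partial>\<^sub>j \<omega>\<^sub>k = \<Gamma>\<^sup>i\<^bsub>jk\<^esub> \<omega>\<^sub>i\<close>, \<open>\<partial>\<^sub>j \<phi> = \<omega>\<^sub>j\<close> for the pair \<open>(\<omega>, \<phi>)\<close>: the vanishing of the curvature
  makes the first part integrable, the symmetry of \<open>\<Gamma>\<close> the second.\<close>

definition coord_system ::
    "('n::finite \<Rightarrow> 'n \<Rightarrow> 'n \<Rightarrow> real^'n \<Rightarrow> real) \<Rightarrow> real^'n \<Rightarrow> (real^'n) \<Rightarrow>\<^sub>L ((real^'n) \<times> real) \<Rightarrow>\<^sub>L ((real^'n) \<times> real)" where
  "coord_system \<Gamma> x = blinfun2 (\<lambda>h w. (0, h \<bullet> fst w)) +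
     (\<Sum>i\<in>UNIV. \<Sum>j\<in>UNIV. \<Sum>k\<in>UNIV. \<Gamma> i j k x *\<^sub>R blinfun2 (\<lambda>h w. ((h $ j * fst w $ i) *\<^sub>R axis k 1, 0)))"

lemma bilinear_coord:
  "bilinear (\<lambda>h (w :: (real^'n) \<times> real). (0 :: real^'n, h \<bullet> fst w))"
  "bilinear (\<lambda>h (w :: (real^'n) \<times> real). ((h $ j * fst w $ i) *\<^sub>R axis k (1::real) :: real^'n, 0 :: real))"
  by (auto simp: bilinear_def inner_add_left inner_add_right algebra_simps intro!: linearI)

lemma sum_axis: "(\<Sum>k\<in>UNIV. c k *\<^sub>R axis k (1::real)) = (\<chi> k. c k)"
  using basis_expansion[of "\<chi> k. c k"] by (simp add: scalar_mult_eq_scaleR)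

text \<open>The coefficients are arbitrary numbers, so that one computation serves both the values
  of \<open>coord_system\<close> and its derivative, where the derivatives of \<Gamma> replace
  \<Gamma>.\<close>

lemma blinfun_sum_coord:
  fixes c :: "'n::finite \<Rightarrow> 'n \<Rightarrow> 'n \<Rightarrow> real" and h :: "real^'n"
  shows "blinfun_apply (blinfun_apply (\<Sum>i\<in>UNIV. \<Sum>j\<in>UNIV. \<Sum>k\<in>UNIV. c i j k *\<^sub>R
       blinfun2 (\<lambda>h (w :: (real^'n) \<times> real). ((h $ j * fst w $ i) *\<^sub>R axis k 1 :: real^'n, 0 :: real))) h) w =
     (\<chi> k. \<Sum>i\<in>UNIV. \<Sum>j\<in>UNIV. c i j k * h $ j * fst w $ i, 0)"
proof -
  have "(\<Sum>i\<in>UNIV. \<Sum>j\<in>UNIV. \<Sum>k\<in>UNIV. (c i j k * h $ j * fst w $ i) *\<^sub>R axis k (1::real)) =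
     (\<chi> k. \<Sum>i\<in>UNIV. \<Sum>j\<in>UNIV. c i j k * h $ j * fst w $ i)"
    unfolding sum_axis by (simp add: vec_eq_iff)
  then show ?thesis
    by (simp add: blinfun.sum_left blinfun.scaleR_left blinfun2_apply[OF bilinear_coord(2)]
        prod_eq_iff fst_sum snd_sum mult_ac)
qed

lemma coord_system_apply:
  "coord_system \<Gamma> x h w = (\<chi> k. \<Sum>i\<in>UNIV. \<Sum>j\<in>UNIV. \<Gamma> i j k x * h $ j * fst w $ i, h \<bullet> fst w)"
  unfolding coord_system_def
  by (simp add: blinfun.add_left blinfun2_apply[OF bilinear_coord(1)] blinfun_sum_coord)

lemma coord_system_smooth:
  assumes "open V" "\<And>i j k. smooth_on V (\<Gamma> i j k)"
  shows "smooth_on V (coord_system \<Gamma>)"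
  using assms unfolding smooth_on_def coord_system_def[abs_def]
  by (intro allI Ck_on_add Ck_on_sum Ck_on_scaleR Ck_on_const) auto

lemma coord_system_frechet:
  assumes "\<And>i j k. smooth_on V (\<Gamma> i j k)" "x \<in> V"
  shows "frechet_derivative (coord_system \<Gamma>) (at x) u v w =
    (\<chi> k. \<Sum>i\<in>UNIV. \<Sum>j\<in>UNIV. frechet_derivative (\<Gamma> i j k) (at x) u * v $ j * fst w $ i, 0)"
proof -
  let ?b = "\<lambda>i j k. blinfun2 (\<lambda>h (w :: (real^'n) \<times> real). ((h $ j * fst w $ i) *\<^sub>R axis k 1 :: real^'n, 0 :: real))"
  have "((\<lambda>x. \<Gamma> i j k x *\<^sub>R ?b i j k) has_derivative (\<lambda>u. frechet_derivative (\<Gamma> i j k) (at x) u *\<^sub>R ?b i j k)) (at x)" for i j k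
    by (rule has_derivative_scaleR_left[OF smooth_on_has_derivative[OF assms]])
  then have "(coord_system \<Gamma> has_derivative (\<lambda>u. 0 + (\<Sum>i\<in>UNIV. \<Sum>j\<in>UNIV. \<Sum>k\<in>UNIV.
      frechet_derivative (\<Gamma> i j k) (at x) u *\<^sub>R ?b i j k))) (at x)"
    unfolding coord_system_def[abs_def]
    by (intro has_derivative_add has_derivative_const has_derivative_sum)
  from frechet_derivative_at[OF this, symmetric] show ?thesis
    by (simp add: blinfun_sum_coord)
qed

text \<open>The a-th solution of \<open>coord_system\<close> is a pair: its second entry is the a-th
  component of \<phi>, its first entry the gradient of that component. The first-order equations for
  the gradients are thus the second-order system for \<phi>.\<close>

theorem flat_coordinates:
  fixes \<Gamma> :: "'n::finite \<Rightarrow> 'n \<Rightarrow> 'n \<Rightarrow> real^'n \<Rightarrow> real"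
  assumes V: "open V" "x0 \<in> V" and sm: "\<And>i j k. smooth_on V (\<Gamma> i j k)"
    and sym: "\<And>i j k x. x \<in> V \<Longrightarrow> \<Gamma> i j k x = \<Gamma> i k j x"
    and flat: "\<And>x l a c k. x \<in> V \<Longrightarrow>
      partial_deriv a (\<Gamma> l c k) x + (\<Sum>s\<in>UNIV. \<Gamma> l a s x * \<Gamma> s c k x) =
      partial_deriv c (\<Gamma> l a k) x + (\<Sum>s\<in>UNIV. \<Gamma> l c s x * \<Gamma> s a k x)"
  obtains U W and \<phi> :: "real^'n \<Rightarrow> real^'n" and g where "open U" "x0 \<in> U" "U \<subseteq> V" "open W" "homeomorphism U W \<phi> g"
    "smooth_on U \<phi>" "smooth_on W g" "\<And>x. x \<in> U \<Longrightarrow> bij (frechet_derivative \<phi> (at x))"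
    "\<And>x j k. x \<in> U \<Longrightarrow> frechet_derivative (\<lambda>y. frechet_derivative \<phi> (at y) (axis k 1)) (at x) (axis j 1) =
       (\<Sum>i\<in>UNIV. \<Gamma> i j k x *\<^sub>R frechet_derivative \<phi> (at x) (axis i 1))"
proof -
  let ?B = "coord_system \<Gamma>"
  let ?B' = "\<lambda>x. frechet_derivative ?B (at x)"
  have smB: "smooth_on V ?B" by (rule coord_system_smooth[OF V(1) sm])
  have axis_sum: "(\<Sum>j\<in>UNIV. f j * axis a (1::real) $ j * c) = f a * c" for f :: "'n \<Rightarrow> real" and a c
    by (simp add: axis_def if_distrib if_distribR sum.delta cong: if_cong)
  have flatB: "?B' x u v w + ?B x v (?B x u w) = ?B' x v u w + ?B x u (?B x v w)" if x: "x \<in> V" for x u v w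
  proof -
    have linB': "linear (?B' x)"
      by (rule bounded_linear.linear[OF has_derivative_bounded_linear[OF smooth_on_has_derivative[OF smB x]]])
    let ?L = "\<lambda>u v. ?B' x u v w + ?B x v (?B x u w)" and ?R = "\<lambda>u v. ?B' x v u w + ?B x u (?B x v w)"
    \<comment> \<open>Both sides are bilinear in the two directions, so coordinate directions
      suffice; there the hypotheses on \<Gamma> can be read off.\<close>
    have "?L = ?R"
    proof (rule bilinear_eq_stdbasis)
      show "bilinear ?L" "bilinear ?R"
        unfolding bilinear_def
        by (auto intro!: linearI simp: linear_add[OF linB'] linear_scale[OF linB'] blinfun.add_left
            blinfun.add_right blinfun.scaleR_left blinfun.scaleR_right scaleR_add_right)
      fix u v :: "real^'n" assume "u \<in> Basis" "v \<in> Basis"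
      then obtain a c where uv: "u = axis a 1" "v = axis c 1" by (auto simp: Basis_vec_def)
      have 1: "fst (?B' x (axis a 1) (axis c 1) w + ?B x (axis c 1) (?B x (axis a 1) w)) $ k =
          (\<Sum>l\<in>UNIV. (partial_deriv a (\<Gamma> l c k) x + (\<Sum>s\<in>UNIV. \<Gamma> l a s x * \<Gamma> s c k x)) * fst w $ l)" for a c k
      proof -
        have "(\<Sum>l\<in>UNIV. (\<Sum>s\<in>UNIV. \<Gamma> l a s x * \<Gamma> s c k x) * fst w $ l) =
            (\<Sum>s\<in>UNIV. \<Gamma> s c k x * (\<Sum>l\<in>UNIV. \<Gamma> l a s x * fst w $ l))"
          unfolding sum_distrib_left sum_distrib_right by (subst sum.swap) (simp add: mult_ac)
        then show ?thesis
          by (simp add: coord_system_frechet[OF sm x] coord_system_apply axis_sum partial_deriv_def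
            distrib_right sum.distrib)
      qed
      \<comment> \<open>The second entry involves only \<open>\<Gamma> l a c\<close>, so its
        invariance under exchange of \<open>a\<close> and \<open>c\<close> is the symmetry of
        \<Gamma>.\<close>
      have 2: "snd (?B' x (axis a 1) (axis c 1) w + ?B x (axis c 1) (?B x (axis a 1) w)) =
          (\<Sum>l\<in>UNIV. \<Gamma> l a c x * fst w $ l)" for a c
        by (simp add: coord_system_frechet[OF sm x] coord_system_apply axis_sum inner_axis' )
      show "?L u v = ?R u v"
        unfolding uv prod_eq_iff vec_eq_iff 1 2 flat[OF x, of a _ c] sym[OF x, of _ a c] by simp
    qed
    then show ?thesis by meson
  qed
  obtain \<rho> where \<rho>: "\<rho> > 0" "ball x0 \<rho> \<subseteq> V"
    "\<And>w0. \<exists>w. w x0 = w0 \<and> smooth_on (ball x0 \<rho>) w \<and>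
      (\<forall>x\<in>ball x0 \<rho>. (w has_derivative (\<lambda>h. ?B x h (w x))) (at x))"
    using flat_linear_system_solution[OF V smB flatB] by blast
  let ?U = "ball x0 \<rho>"
  \<comment> \<open>The initial gradients \<open>axis a 1\<close> make the derivative of \<phi> at
    \<open>x0\<close> the identity, as \<open>smooth_inverse_function\<close> asks; the value 0
    sends \<open>x0\<close> to the origin.\<close>
  have "\<forall>a. \<exists>w. w x0 = (axis a 1, 0) \<and> smooth_on ?U w \<and>
      (\<forall>x\<in>?U. (w has_derivative (\<lambda>h. ?B x h (w x))) (at x))"
    using \<rho>(3) by blast
  from choice[OF this] obtain w where w: "\<And>a. w a x0 = (axis a 1, 0)" "\<And>a. smooth_on ?U (w a)"
    "\<And>a x. x \<in> ?U \<Longrightarrow> (w a has_derivative (\<lambda>h. ?B x h (w a x))) (at x)"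
    by blast
  define \<phi> where "\<phi> x = (\<chi> a. snd (w a x))" for x
  have "smooth_on ?U \<phi>"
    unfolding smooth_on_def
  proof (intro allI Ck_on_vec open_ball)
    fix k a
    have "Ck_on k ?U (\<lambda>x. snd (w a x))"
      using w(2) by (intro Ck_on_bounded_linear[OF open_ball bounded_linear_snd]) (simp add: smooth_on_def)
    then show "Ck_on k ?U (\<lambda>x. \<phi> x $ a)" by (simp add: \<phi>_def)
  qed
  have d\<phi>: "(\<phi> has_derivative (\<lambda>h. \<chi> a. h \<bullet> fst (w a x))) (at x)" if x: "x \<in> ?U" for x
  proof -
    have "((\<lambda>x. \<phi> x $ a) has_derivative (\<lambda>h. h \<bullet> fst (w a x))) (at x)" for a
      using has_derivative_snd[OF w(3)[OF x, of a]] by (simp add: \<phi>_def coord_system_apply)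
    then show ?thesis
      by (subst has_derivative_componentwise_within) (auto simp: Basis_vec_def inner_axis)
  qed
  have D\<phi>: "frechet_derivative \<phi> (at x) h = (\<chi> a. h \<bullet> fst (w a x))" if "x \<in> ?U" for x h
    using frechet_derivative_at[OF d\<phi>[OF that]] by metis
  have id: "frechet_derivative \<phi> (at x0) h = h" for h
    using \<rho>(1) by (simp add: D\<phi> w(1) inner_axis vec_eq_iff)
  have sys: "frechet_derivative (\<lambda>y. frechet_derivative \<phi> (at y) (axis k 1)) (at x) (axis j 1) =
       (\<Sum>i\<in>UNIV. \<Gamma> i j k x *\<^sub>R frechet_derivative \<phi> (at x) (axis i 1))" if x: "x \<in> ?U" for x j k
  proof -
    have c: "((\<lambda>y. fst (w a y) $ k) has_derivative (\<lambda>h. fst (?B x h (w a x)) $ k)) (at x)" for a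
      using bounded_linear.has_derivative[OF bounded_linear_vec_nth has_derivative_fst[OF w(3)[OF x]]] .
    have "((\<lambda>y. \<chi> a. fst (w a y) $ k) has_derivative (\<lambda>h. \<chi> a. fst (?B x h (w a x)) $ k)) (at x)"
      by (subst has_derivative_componentwise_within) (use c in \<open>auto simp: Basis_vec_def inner_axis\<close>)
    then have "((\<lambda>y. frechet_derivative \<phi> (at y) (axis k 1)) has_derivative
        (\<lambda>h. \<chi> a. fst (?B x h (w a x)) $ k)) (at x)"
      by (rule has_derivative_transform_within_open[OF _ open_ball x]) (simp add: D\<phi> inner_axis')
    from frechet_derivative_at[OF this, symmetric] show ?thesis
      by (simp add: vec_eq_iff D\<phi>[OF x] coord_system_apply axis_sum inner_axis')
  qed
  from smooth_inverse_function[OF open_ball \<open>smooth_on ?U \<phi>\<close> _ id] \<rho>(1)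
  obtain U' W g where *: "open U'" "U' \<subseteq> ?U" "x0 \<in> U'" "open W" "homeomorphism U' W \<phi> g"
    "smooth_on W g" "\<And>x. x \<in> U' \<Longrightarrow> bij (frechet_derivative \<phi> (at x))" by auto
  show thesis
    by (rule that[OF *(1,3) _ *(4,5) smooth_on_mono[OF *(2) \<open>smooth_on ?U \<phi>\<close>] *(6)])
      (use sys *(2,7) \<rho>(2) in blast)+
qed

section \<open>Change of charts\<close>

text \<open>Both functions have the same derivatives at \<open>x\<close>, so the choice operator
  behind \<open>frechet_derivative\<close> returns the same map, even where neither is
  differentiable.\<close>

lemma frechet_derivative_cong_open:
  assumes "open S" "x \<in> S" "\<And>y. y \<in> S \<Longrightarrow> f y = g y"
  shows "frechet_derivative f (at x) = frechet_derivative g (at x)"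
proof -
  have "(f has_derivative D) (at x) \<longleftrightarrow> (g has_derivative D) (at x)" for D
    using has_derivative_transform_within_open[OF _ assms(1,2)] assms(3) by metis
  then show ?thesis by (simp add: frechet_derivative_def)
qed

lemma is_chart_inj: "is_chart M c \<Longrightarrow> inj_on (chart_map c) (chart_dom c)"
  unfolding is_chart_def
  by (metis homeomorphic_imp_injective_map openin_subset topspace_subtopology_subset)

lemma is_chart_open_image:
  assumes "is_chart M c" "openin M W" "W \<subseteq> chart_dom c"
  shows "open (chart_map c ` W)"
proof -
  have "openin (subtopology M (chart_dom c)) W"
    using assms by (simp add: is_chart_def openin_open_subtopology)
  then have "openin (top_of_set (chart_map c ` chart_dom c)) (chart_map c ` W)"
    using assms(1) homeomorphic_imp_open_map unfolding is_chart_def open_map_def by blast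
  then show ?thesis using assms(1) openin_open_trans unfolding is_chart_def by blast
qed

lemma in_coords_at: "is_chart M c \<Longrightarrow> p \<in> chart_dom c \<Longrightarrow> in_coords c f (chart_map c p) = f p"
  unfolding in_coords_def by (simp add: is_chart_inj)

lemma in_coords_comp: "in_coords c (\<lambda>p. F (f p)) = (\<lambda>x. F (in_coords c f x))"
  by (simp add: in_coords_def comp_def)

lemma linear_axis_expansion:
  fixes L :: "real^'n \<Rightarrow> 'b::real_vector"
  assumes "linear L"
  shows "L v = (\<Sum>i\<in>UNIV. v $ i *\<^sub>R L (axis i 1))"
proof -
  have "L v = L (\<Sum>i\<in>UNIV. v $ i *\<^sub>R axis i 1)"
    using sum_axis[of "\<lambda>i. v $ i"] by simp
  then show ?thesis by (simp add: linear_sum[OF assms] linear_scale[OF assms])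
qed

section \<open>Transition maps and vector fields\<close>

locale manifold =
  fixes M :: "'a topology" and A :: "('a, 'n::finite) chart set"
  assumes manifold: "smooth_manifold M A"
begin

lemma chart: "c \<in> A \<Longrightarrow> is_chart M c"
  using manifold unfolding smooth_manifold_def by blast

lemma openin_dom: "c \<in> A \<Longrightarrow> openin M (chart_dom c)"
  using chart is_chart_def by blast

lemma open_image: "c \<in> A \<Longrightarrow> openin M W \<Longrightarrow> open (chart_map c ` (W \<inter> chart_dom c))"
  by (rule is_chart_open_image[OF chart]) (auto intro: openin_dom)

lemmas in_coords_chart = in_coords_at[OF chart]

lemma transition_smooth:
  assumes "c \<in> A" "d \<in> A"
  shows "smooth_on (chart_map c ` (chart_dom c \<inter> chart_dom d)) (in_coords c (chart_map d))"
  using assms manifold unfolding smooth_manifold_def smooth_compatible_def by blast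

lemma transition_derivative:
  assumes "c \<in> A" "d \<in> A" "p \<in> chart_dom c \<inter> chart_dom d"
  shows "(in_coords c (chart_map d) has_derivative
     frechet_derivative (in_coords c (chart_map d)) (at (chart_map c p))) (at (chart_map c p))"
  using smooth_on_has_derivative[OF transition_smooth] assms by blast

text \<open>Near the image of \<open>p\<close>, \<open>in_coords c f\<close> is
  \<open>in_coords d f\<close> after the transition map. The transformation of coordinate fields and
  the change of chart in a derivative \<open>X f\<close> rest on this.\<close>

lemma in_coords_chain:
  assumes c: "c \<in> A" "d \<in> A" "p \<in> chart_dom c \<inter> chart_dom d"
    and f: "(in_coords d f has_derivative D) (at (chart_map d p))"
  shows "(in_coords c f has_derivative
     (\<lambda>h. D (frechet_derivative (in_coords c (chart_map d)) (at (chart_map c p)) h))) (at (chart_map c p))"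
proof (rule has_derivative_transform_within_open)
  have eq: "in_coords c (chart_map d) (chart_map c q) = chart_map d q" if "q \<in> chart_dom c" for q
    using in_coords_chart[OF c(1) that] .
  show "((\<lambda>x. in_coords d f (in_coords c (chart_map d) x)) has_derivative
     (\<lambda>h. D (frechet_derivative (in_coords c (chart_map d)) (at (chart_map c p)) h))) (at (chart_map c p))"
    by (rule has_derivative_compose[OF transition_derivative[OF c]]) (use f eq c(3) in simp)
  show "open (chart_map c ` (chart_dom d \<inter> chart_dom c))" by (rule open_image[OF c(1) openin_dom[OF c(2)]])
  show "chart_map c p \<in> chart_map c ` (chart_dom d \<inter> chart_dom c)" using c(3) by blast
  fix x assume "x \<in> chart_map c ` (chart_dom d \<inter> chart_dom c)"
  then show "in_coords d f (in_coords c (chart_map d) x) = in_coords c f x"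
    using eq in_coords_chart[OF c(1), of _ f] in_coords_chart[OF c(2), of _ f] by auto
qed

lemma frechet_self:
  assumes "c \<in> A" "p \<in> chart_dom c"
  shows "frechet_derivative (in_coords c (chart_map c)) (at (chart_map c p)) = (\<lambda>h. h)"
proof -
  have "frechet_derivative (in_coords c (chart_map c)) (at (chart_map c p)) = frechet_derivative (\<lambda>x. x) (at (chart_map c p))"
    by (rule frechet_derivative_cong_open[OF open_image[OF assms(1) openin_dom[OF assms(1)]]])
      (use assms in_coords_chart[OF assms(1)] in auto)
  then show ?thesis by simp
qed

lemma transition_inverse:
  assumes "c \<in> A" "d \<in> A" "p \<in> chart_dom c \<inter> chart_dom d"
  shows "frechet_derivative (in_coords d (chart_map c)) (at (chart_map d p))
     (frechet_derivative (in_coords c (chart_map d)) (at (chart_map c p)) h) = h"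
proof -
  have "(in_coords d (chart_map c) has_derivative frechet_derivative (in_coords d (chart_map c)) (at (chart_map d p))) (at (chart_map d p))"
    using transition_derivative[of d c p] assms by blast
  from frechet_derivative_at[OF in_coords_chain[OF assms this]] frechet_self[OF assms(1)] assms(3)
  show ?thesis by (metis IntD1)
qed

text \<open>Smoothness of functions and fields is demanded in every chart, whereas Jacobian entries
  are given by a formula in the coordinates of one chart.\<close>

lemma smooth_transfer:
  assumes c: "c \<in> A" "d \<in> A" and W: "openin M W" "W \<subseteq> chart_dom c"
    and F: "smooth_on (chart_map c ` W) F"
  shows "smooth_on (chart_map d ` (W \<inter> chart_dom d)) (in_coords d (\<lambda>p. F (chart_map c p)))"
  unfolding in_coords_comp
proof (rule smooth_on_compose[OF open_image[OF c(2) W(1)] is_chart_open_image[OF chart[OF c(1)] W] _ _ F])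
  show "in_coords d (chart_map c) ` chart_map d ` (W \<inter> chart_dom d) \<subseteq> chart_map c ` W"
    using in_coords_chart[OF c(2), of _ "chart_map c"] by auto
  show "smooth_on (chart_map d ` (W \<inter> chart_dom d)) (in_coords d (chart_map c))"
    by (rule smooth_on_mono[OF _ transition_smooth[OF c(2,1)]]) (use W in auto)
qed

lemma coord_vfield_smooth:
  assumes c: "c \<in> A"
  shows "smooth_vfield A (chart_dom c) (coord_vfield c j)"
  unfolding smooth_vfield_def
proof (intro conjI ballI)
  fix d assume d: "d \<in> A"
  let ?W = "chart_dom c \<inter> chart_dom d"
  have "smooth_on (chart_map c ` ?W) (\<lambda>x. frechet_derivative (in_coords c (chart_map d)) (at x) (axis j 1))"
    by (rule smooth_on_frechet[OF transition_smooth[OF c d]])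
  from smooth_transfer[OF c d _ _ this]
  show "smooth_on (chart_map d ` (chart_dom c \<inter> chart_dom d)) (in_coords d (coord_vfield c j d))"
    unfolding coord_vfield_def by (simp add: openin_dom c d openin_Int Int_assoc)
next
  fix d e p assume *: "d \<in> A" "e \<in> A" "p \<in> chart_dom c \<inter> chart_dom d \<inter> chart_dom e"
  have "(in_coords d (chart_map e) has_derivative frechet_derivative (in_coords d (chart_map e)) (at (chart_map d p))) (at (chart_map d p))"
    using transition_derivative[of d e p] * by blast
  from frechet_derivative_at[OF in_coords_chain[OF c *(1) _ this]] *(3)
  show "coord_vfield c j e p = frechet_derivative (in_coords d (chart_map e)) (at (chart_map d p)) (coord_vfield c j d p)"
    unfolding coord_vfield_def by (metis IntD1 IntI IntD2)
qed

lemma coord_vfield_self: "c \<in> A \<Longrightarrow> p \<in> chart_dom c \<Longrightarrow> coord_vfield c j c p = axis j 1"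
  unfolding coord_vfield_def by (simp add: frechet_self)

lemma smooth_vfield_mono:
  "V \<subseteq> U \<Longrightarrow> smooth_vfield A U X \<Longrightarrow> smooth_vfield A V X"
  unfolding smooth_vfield_def by (meson Int_mono image_mono order_refl smooth_on_mono subsetD)

lemma transition_linear:
  assumes "c \<in> A" "d \<in> A" "p \<in> chart_dom c \<inter> chart_dom d"
  shows "linear (frechet_derivative (in_coords c (chart_map d)) (at (chart_map c p)))"
  by (rule bounded_linear.linear[OF has_derivative_bounded_linear[OF transition_derivative[OF assms]]])

lemma smooth_vfield_zero: "smooth_vfield A U (\<lambda>_ _. 0)"
  unfolding smooth_vfield_def
proof (intro conjI ballI)
  fix c :: "('a, 'n) chart"
  show "smooth_on (chart_map c ` (U \<inter> chart_dom c)) (in_coords c (\<lambda>_. 0 :: real^'n))"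
    by (simp add: in_coords_def comp_def smooth_on_def Ck_on_const)
qed (use linear_0[OF transition_linear] in auto)

lemma smooth_vfield_add:
  assumes U: "openin M U" and X: "smooth_vfield A U X" and Y: "smooth_vfield A U Y"
  shows "smooth_vfield A U (vfield_add X Y)"
  unfolding smooth_vfield_def
proof (intro conjI ballI)
  fix c assume c: "c \<in> A"
  have "smooth_on (chart_map c ` (U \<inter> chart_dom c)) (\<lambda>x. in_coords c (X c) x + in_coords c (Y c) x)"
    using X Y c unfolding smooth_vfield_def smooth_on_def by (intro allI Ck_on_add open_image[OF c U]) auto
  then show "smooth_on (chart_map c ` (U \<inter> chart_dom c)) (in_coords c (vfield_add X Y c))"
    by (simp add: vfield_add_def in_coords_def comp_def)
next
  fix c d p assume *: "c \<in> A" "d \<in> A" "p \<in> U \<inter> chart_dom c \<inter> chart_dom d"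
  then have lin: "linear (frechet_derivative (in_coords c (chart_map d)) (at (chart_map c p)))"
    by (intro transition_linear) auto
  have "X d p = frechet_derivative (in_coords c (chart_map d)) (at (chart_map c p)) (X c p)"
    "Y d p = frechet_derivative (in_coords c (chart_map d)) (at (chart_map c p)) (Y c p)"
    using * X Y unfolding smooth_vfield_def by blast+
  then show "vfield_add X Y d p = frechet_derivative (in_coords c (chart_map d)) (at (chart_map c p)) (vfield_add X Y c p)"
    by (simp only: vfield_add_def linear_add[OF lin])
qed

lemma smooth_vfield_mult:
  assumes U: "openin M U" and f: "smooth_fun A U f" and X: "smooth_vfield A U X"
  shows "smooth_vfield A U (vfield_mult f X)"
  unfolding smooth_vfield_def
proof (intro conjI ballI)
  fix c assume c: "c \<in> A"
  have "smooth_on (chart_map c ` (U \<inter> chart_dom c)) (\<lambda>x. in_coords c f x *\<^sub>R in_coords c (X c) x)"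
    using X f c unfolding smooth_vfield_def smooth_fun_def smooth_on_def by (intro allI Ck_on_scaleR open_image[OF c U]) auto
  then show "smooth_on (chart_map c ` (U \<inter> chart_dom c)) (in_coords c (vfield_mult f X c))"
    by (simp add: vfield_mult_def in_coords_def comp_def)
next
  fix c d p assume *: "c \<in> A" "d \<in> A" "p \<in> U \<inter> chart_dom c \<inter> chart_dom d"
  then have lin: "linear (frechet_derivative (in_coords c (chart_map d)) (at (chart_map c p)))"
    by (intro transition_linear) auto
  have "X d p = frechet_derivative (in_coords c (chart_map d)) (at (chart_map c p)) (X c p)"
    using * X unfolding smooth_vfield_def by blast
  then show "vfield_mult f X d p = frechet_derivative (in_coords c (chart_map d)) (at (chart_map c p)) (vfield_mult f X c p)"
    by (simp only: vfield_mult_def linear_scale[OF lin])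
qed

text \<open>The axioms of a connection treat two summands and one factor at a time, whereas a change
  of charts expands a coordinate field in all coordinate fields of the other chart.\<close>

definition vfield_sum :: "'i set \<Rightarrow> ('i \<Rightarrow> 'a \<Rightarrow> real) \<Rightarrow> ('i \<Rightarrow> ('a, 'n) vfield) \<Rightarrow> ('a, 'n) vfield" where
  "vfield_sum I f X = (\<lambda>c p. \<Sum>b\<in>I. f b p *\<^sub>R X b c p)"

lemma vfield_sum_empty: "vfield_sum {} f X = (\<lambda>_ _. 0)"
  by (simp add: vfield_sum_def)

lemma vfield_sum_insert:
  "finite I \<Longrightarrow> b \<notin> I \<Longrightarrow> vfield_sum (insert b I) f X = vfield_add (vfield_mult (f b) (X b)) (vfield_sum I f X)"
  by (simp add: vfield_sum_def vfield_add_def vfield_mult_def)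

lemma vfield_sum_smooth:
  assumes "finite I" "openin M U" "\<And>b. b \<in> I \<Longrightarrow> smooth_fun A U (f b)" "\<And>b. b \<in> I \<Longrightarrow> smooth_vfield A U (X b)"
  shows "smooth_vfield A U (vfield_sum I f X)"
  using assms(1,3,4)
  by (induction I rule: finite_induct)
    (auto simp: vfield_sum_empty vfield_sum_insert smooth_vfield_zero intro!: smooth_vfield_add smooth_vfield_mult assms(2))

end

section \<open>The connection and its Christoffel symbols\<close>

locale affine_manifold = manifold M A for M :: "'a topology" and A :: "('a, 'n::finite) chart set" +
  fixes nabla :: "('a, 'n) cov_deriv"
  assumes connection: "affine_connection M A nabla"
begin

lemma vfield_eqD: "vfield_eq A U X Y \<Longrightarrow> c \<in> A \<Longrightarrow> p \<in> U \<inter> chart_dom c \<Longrightarrow> X c p = Y c p"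
  unfolding vfield_eq_def by blast

lemmas connection_clauses = connection[unfolded affine_connection_def]

lemma nabla_smooth:
  assumes "openin M U" "smooth_vfield A U X" "smooth_vfield A U Y"
  shows "smooth_vfield A U (nabla U X Y)"
  using connection_clauses[THEN conjunct1, rule_format, of U X Y] assms by (simp only: simp_thms)

text \<open>The one property that relates different open sets. It permits both shrinking a chart
  domain to an overlap and replacing a field by another with the same components there.\<close>

lemma nabla_local:
  assumes "openin M U" "openin M V" "V \<subseteq> U" "smooth_vfield A U X" "smooth_vfield A U Y"
    "smooth_vfield A V X'" "smooth_vfield A V Y'" "vfield_eq A V X X'" "vfield_eq A V Y Y'"
    and p: "c \<in> A" "p \<in> V \<inter> chart_dom c"
  shows "nabla U X Y c p = nabla V X' Y' c p"
  by (rule vfield_eqD[OF _ p], rule connection_clauses[THEN conjunct2, THEN conjunct1, rule_format])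
    (intro conjI assms)

lemma nabla_add_left:
  assumes "openin M U" "smooth_vfield A U X" "smooth_vfield A U X'" "smooth_vfield A U Y"
    and p: "c \<in> A" "p \<in> U \<inter> chart_dom c"
  shows "nabla U (vfield_add X X') Y c p = nabla U X Y c p + nabla U X' Y c p"
  using vfield_eqD[OF connection_clauses[THEN conjunct2, THEN conjunct2, THEN conjunct1, rule_format, of U X X' Y] p]
    assms by (simp only: vfield_add_def[of "nabla U X Y"] simp_thms)

lemma nabla_mult_left:
  assumes "openin M U" "smooth_fun A U f" "smooth_vfield A U X" "smooth_vfield A U Y"
    and p: "c \<in> A" "p \<in> U \<inter> chart_dom c"
  shows "nabla U (vfield_mult f X) Y c p = f p *\<^sub>R nabla U X Y c p"
  using vfield_eqD[OF connection_clauses[THEN conjunct2, THEN conjunct2, THEN conjunct2, THEN conjunct1,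
      rule_format, of U f X Y] p]
    assms by (simp only: vfield_mult_def[of f "nabla U X Y"] simp_thms)

lemma nabla_add_right:
  assumes "openin M U" "smooth_vfield A U X" "smooth_vfield A U Y" "smooth_vfield A U Y'"
    and p: "c \<in> A" "p \<in> U \<inter> chart_dom c"
  shows "nabla U X (vfield_add Y Y') c p = nabla U X Y c p + nabla U X Y' c p"
  using vfield_eqD[OF connection_clauses[THEN conjunct2, THEN conjunct2, THEN conjunct2, THEN conjunct2,
      THEN conjunct1, rule_format, of U X Y Y'] p]
    assms by (simp only: vfield_add_def[of "nabla U X Y"] simp_thms)

lemma nabla_leibniz:
  assumes "openin M U" "smooth_fun A U f" "smooth_vfield A U X" "smooth_vfield A U Y"
    and p: "c \<in> A" "p \<in> U \<inter> chart_dom c"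
  shows "nabla U X (vfield_mult f Y) c p = f p *\<^sub>R nabla U X Y c p + vfield_apply c X f p *\<^sub>R Y c p"
  using connection_clauses[THEN conjunct2, THEN conjunct2, THEN conjunct2, THEN conjunct2, THEN conjunct2,
      rule_format, of U f X Y c p] assms by (simp only: simp_thms)

lemma nabla_sum_left:
  assumes "finite I" and U: "openin M U" and "\<And>b. b \<in> I \<Longrightarrow> smooth_fun A U (f b)"
    and "\<And>b. b \<in> I \<Longrightarrow> smooth_vfield A U (X b)"
    and Y: "smooth_vfield A U Y" and p: "c \<in> A" "p \<in> U \<inter> chart_dom c"
  shows "nabla U (vfield_sum I f X) Y c p = (\<Sum>b\<in>I. f b p *\<^sub>R nabla U (X b) Y c p)"
  using assms(1,3,4)
proof (induction I rule: finite_induct)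
  case empty
  \<comment> \<open>Additivity at 0 + 0 gives N = N + N, so the covariant derivative along the zero
    field vanishes.\<close>
  have "vfield_add (\<lambda>_ _. 0) (\<lambda>_ _. 0) = ((\<lambda>_ _. 0) :: ('a, 'n) vfield)" by (simp add: vfield_add_def)
  with nabla_add_left[OF U smooth_vfield_zero smooth_vfield_zero Y p] show ?case
    by (simp add: vfield_sum_empty)
next
  case (insert b I)
  then show ?case
    by (simp add: vfield_sum_insert nabla_add_left[OF U smooth_vfield_mult[OF U] vfield_sum_smooth[OF _ U] Y p]
        nabla_mult_left[OF U _ _ Y p])
qed

lemma nabla_sum_right:
  assumes "finite I" and U: "openin M U" and "\<And>b. b \<in> I \<Longrightarrow> smooth_fun A U (f b)"
    and "\<And>b. b \<in> I \<Longrightarrow> smooth_vfield A U (Y b)"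
    and X: "smooth_vfield A U X" and p: "c \<in> A" "p \<in> U \<inter> chart_dom c"
  shows "nabla U X (vfield_sum I f Y) c p =
    (\<Sum>b\<in>I. f b p *\<^sub>R nabla U X (Y b) c p + vfield_apply c X (f b) p *\<^sub>R Y b c p)"
  using assms(1,3,4)
proof (induction I rule: finite_induct)
  case empty
  have "vfield_add (\<lambda>_ _. 0) (\<lambda>_ _. 0) = ((\<lambda>_ _. 0) :: ('a, 'n) vfield)" by (simp add: vfield_add_def)
  with nabla_add_right[OF U X smooth_vfield_zero smooth_vfield_zero p] show ?case
    by (simp add: vfield_sum_empty)
next
  case (insert b I)
  then show ?case
    by (simp add: vfield_sum_insert nabla_add_right[OF U X smooth_vfield_mult[OF U] vfield_sum_smooth[OF _ U] p]
        nabla_leibniz[OF U _ X _ p])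
qed

lemma christoffel_smooth:
  assumes "c \<in> A"
  shows "smooth_on (chart_map c ` chart_dom c) (christoffel nabla c i j k)"
proof -
  let ?N = "nabla (chart_dom c) (coord_vfield c j) (coord_vfield c k)"
  have "smooth_vfield A (chart_dom c) ?N"
    by (intro nabla_smooth openin_dom coord_vfield_smooth assms)
  then have "smooth_on (chart_map c ` chart_dom c) (in_coords c (?N c))"
    using assms unfolding smooth_vfield_def by force
  then have "smooth_on (chart_map c ` chart_dom c) (\<lambda>x. in_coords c (?N c) x $ i)"
    using open_image[OF assms openin_dom[OF assms]] unfolding smooth_on_def by (auto intro: Ck_on_nth)
  then show ?thesis unfolding christoffel_def in_coords_def comp_def .
qed

lemma christoffel_at:
  "c \<in> A \<Longrightarrow> p \<in> chart_dom c \<Longrightarrow> christoffel nabla c i j k (chart_map c p) =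
    nabla (chart_dom c) (coord_vfield c j) (coord_vfield c k) c p $ i"
  unfolding christoffel_def by (rule in_coords_chart)

text \<open>The components in \<open>d\<close> of the covariant derivative of one coordinate field
  of \<open>c\<close> along another are computed twice: by transforming the components in
  \<open>c\<close>, and by expanding both fields in coordinate fields of \<open>d\<close>. The
  Leibniz rule produces the second derivative of the transition map.\<close>

lemma christoffel_transformation:
  assumes c: "c \<in> A" and d: "d \<in> A" and p: "p \<in> chart_dom c \<inter> chart_dom d"
  defines "\<phi> \<equiv> in_coords c (chart_map d)" and "x \<equiv> chart_map c p"
  shows "(\<Sum>i\<in>UNIV. christoffel nabla c i j k x *\<^sub>R frechet_derivative \<phi> (at x) (axis i 1)) =
    frechet_derivative (\<lambda>y. frechet_derivative \<phi> (at y) (axis k 1)) (at x) (axis j 1) +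
    (\<Sum>b\<in>UNIV. \<Sum>a\<in>UNIV. (frechet_derivative \<phi> (at x) (axis k 1) $ b * frechet_derivative \<phi> (at x) (axis j 1) $ a)
       *\<^sub>R (\<chi> i. christoffel nabla d i a b (chart_map d p)))"
proof -
  let ?W = "chart_dom c \<inter> chart_dom d"
  let ?E = "coord_vfield c" and ?F = "coord_vfield d"
  \<comment> \<open>Jacobian entries of the transition from \<open>c\<close> to \<open>d\<close>, as
    functions on the manifold; they are the coefficients of the expansion \<open>?S\<close>.\<close>
  let ?J = "\<lambda>k b p. coord_vfield c k d p $ b"
  let ?S = "\<lambda>k. vfield_sum UNIV (?J k) ?F"
  have W: "openin M ?W" by (intro openin_Int openin_dom c d)
  have E: "smooth_vfield A ?W (?E k)" and F: "smooth_vfield A ?W (?F k)" for k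
    using smooth_vfield_mono[OF _ coord_vfield_smooth] c d by auto
  have J_at: "in_coords c (?J k b) y = frechet_derivative \<phi> (at y) (axis k 1) $ b" if "y \<in> chart_map c ` ?W" for k b y
    using that in_coords_chart[OF c, of _ "?J k b"] unfolding coord_vfield_def \<phi>_def by auto
  have sm\<phi>: "smooth_on (chart_map c ` ?W) (\<lambda>y. frechet_derivative \<phi> (at y) (axis k 1))" for k
    unfolding \<phi>_def by (rule smooth_on_frechet[OF transition_smooth[OF c d]])
  have opW: "open (chart_map c ` ?W)"
    using is_chart_open_image[OF chart[OF c] W] by blast
  have J: "smooth_fun A ?W (?J k b)" for k b
    unfolding smooth_fun_def
  proof
    fix e assume e: "e \<in> A"
    have "smooth_on (chart_map c ` ?W) (\<lambda>y. frechet_derivative \<phi> (at y) (axis k 1) $ b)"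
      using sm\<phi> unfolding smooth_on_def by (auto intro: Ck_on_nth opW)
    from smooth_transfer[OF c e W _ this]
    show "smooth_on (chart_map e ` (?W \<inter> chart_dom e)) (in_coords e (?J k b))"
      unfolding coord_vfield_def \<phi>_def by simp
  qed
  have S: "smooth_vfield A ?W (?S k)" for k
    by (rule vfield_sum_smooth) (use W J F in auto)
  have ES: "?E k e q = ?S k e q" if "e \<in> A" "q \<in> ?W \<inter> chart_dom e" for k e q
  proof -
    have "?E k e q = frechet_derivative (in_coords d (chart_map e)) (at (chart_map d q)) (?E k d q)"
      using coord_vfield_smooth[OF c, of k] d that unfolding smooth_vfield_def by blast
    also have "\<dots> = (\<Sum>b\<in>UNIV. ?E k d q $ b *\<^sub>R frechet_derivative (in_coords d (chart_map e)) (at (chart_map d q)) (axis b 1))"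
      by (rule linear_axis_expansion[OF transition_linear]) (use d that in auto)
    finally show ?thesis by (simp add: vfield_sum_def coord_vfield_def[of d])
  qed
  then have eq: "vfield_eq A ?W (?E k) (?S k)" for k by (simp add: vfield_eq_def)
  have pW: "p \<in> ?W \<inter> chart_dom d" using p by blast
  let ?N = "nabla (chart_dom c) (?E j) (?E k)"
  have sN: "smooth_vfield A (chart_dom c) ?N"
    by (intro nabla_smooth openin_dom coord_vfield_smooth c)
  have lhs: "?N d p = (\<Sum>i\<in>UNIV. christoffel nabla c i j k x *\<^sub>R frechet_derivative \<phi> (at x) (axis i 1))"
  proof -
    have "?N d p = frechet_derivative \<phi> (at x) (?N c p)"
      using sN c d p unfolding smooth_vfield_def \<phi>_def x_def by blast
    also have "\<dots> = (\<Sum>i\<in>UNIV. ?N c p $ i *\<^sub>R frechet_derivative \<phi> (at x) (axis i 1))"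
      unfolding \<phi>_def x_def by (rule linear_axis_expansion[OF transition_linear[OF c d p]])
    finally show ?thesis using p by (simp add: x_def christoffel_at[OF c])
  qed
  have Sj: "?S j d p = frechet_derivative \<phi> (at x) (axis j 1)"
    using ES[OF d pW, of j] by (simp add: coord_vfield_def \<phi>_def x_def)
  \<comment> \<open>The Leibniz term is a derivative in the coordinates of \<open>d\<close>; the
    chain rule carries it to those of \<open>c\<close>, where the direction becomes
    \<open>axis j 1\<close>.\<close>
  have D2: "vfield_apply d (?S j) (?J k b) p =
      frechet_derivative (\<lambda>y. frechet_derivative \<phi> (at y) (axis k 1)) (at x) (axis j 1) $ b" for b
  proof -
    have "chart_map d p \<in> chart_map d ` (?W \<inter> chart_dom d)" using p by blast
    then have "(in_coords d (?J k b) has_derivative frechet_derivative (in_coords d (?J k b)) (at (chart_map d p))) (at (chart_map d p))"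
      using J[of k b] d unfolding smooth_fun_def by (intro smooth_on_has_derivative) auto
    from frechet_derivative_at[OF in_coords_chain[OF c d p this]]
    have "vfield_apply d (?S j) (?J k b) p = frechet_derivative (in_coords c (?J k b)) (at x) (axis j 1)"
      unfolding vfield_apply_def Sj \<phi>_def x_def by metis
    also have "\<dots> = frechet_derivative (\<lambda>y. frechet_derivative \<phi> (at y) (axis k 1) $ b) (at x) (axis j 1)"
      by (subst frechet_derivative_cong_open[OF opW _ J_at]) (use p in \<open>auto simp: x_def\<close>)
    also have "\<dots> = frechet_derivative (\<lambda>y. frechet_derivative \<phi> (at y) (axis k 1)) (at x) (axis j 1) $ b"
    proof -
      have "x \<in> chart_map c ` ?W" using p by (auto simp: x_def)
      from frechet_derivative_at[OF bounded_linear.has_derivative[OF bounded_linear_vec_nth smooth_on_has_derivative[OF sm\<phi> this]]]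
      show ?thesis by metis
    qed
    finally show ?thesis .
  qed
  \<comment> \<open>Locality shrinks the domain to the overlap and replaces both fields by their
    expansions at once.\<close>
  have "?N d p = nabla ?W (?S j) (?S k) d p"
    by (rule nabla_local[OF openin_dom[OF c] W _ coord_vfield_smooth[OF c] coord_vfield_smooth[OF c] S S eq eq d pW]) blast
  also have "\<dots> = (\<Sum>b\<in>UNIV. ?J k b p *\<^sub>R nabla ?W (?S j) (?F b) d p + vfield_apply d (?S j) (?J k b) p *\<^sub>R ?F b d p)"
    by (rule nabla_sum_right[OF finite W J F S d pW])
  also have "\<dots> = (\<Sum>b\<in>UNIV. ?J k b p *\<^sub>R (\<Sum>a\<in>UNIV. ?J j a p *\<^sub>R nabla ?W (?F a) (?F b) d p)) +
     (\<Sum>b\<in>UNIV. vfield_apply d (?S j) (?J k b) p *\<^sub>R ?F b d p)"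
    by (simp only: sum.distrib nabla_sum_left[OF finite W J F F d pW])
  also have "(\<Sum>b\<in>UNIV. vfield_apply d (?S j) (?J k b) p *\<^sub>R ?F b d p) =
      frechet_derivative (\<lambda>y. frechet_derivative \<phi> (at y) (axis k 1)) (at x) (axis j 1)"
    using p by (simp add: D2 coord_vfield_self[OF d] sum_axis)
  also have "(\<Sum>b\<in>UNIV. ?J k b p *\<^sub>R (\<Sum>a\<in>UNIV. ?J j a p *\<^sub>R nabla ?W (?F a) (?F b) d p)) =
     (\<Sum>b\<in>UNIV. \<Sum>a\<in>UNIV. (frechet_derivative \<phi> (at x) (axis k 1) $ b * frechet_derivative \<phi> (at x) (axis j 1) $ a)
       *\<^sub>R (\<chi> i. christoffel nabla d i a b (chart_map d p)))"
  proof -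
    have "nabla ?W (?F a) (?F b) d p = (\<chi> i. christoffel nabla d i a b (chart_map d p))" for a b
    proof -
      have "nabla (chart_dom d) (?F a) (?F b) d p = nabla ?W (?F a) (?F b) d p"
        by (rule nabla_local[OF openin_dom[OF d] W _ coord_vfield_smooth[OF d] coord_vfield_smooth[OF d] F F _ _ d pW])
          (auto simp: vfield_eq_def)
      then show ?thesis using p by (simp add: christoffel_at[OF d] vec_eq_iff)
    qed
    then show ?thesis by (simp add: scaleR_sum_right coord_vfield_def \<phi>_def x_def)
  qed
  finally show ?thesis using lhs by (simp add: add.commute)
qed

end

section \<open>Flat charts\<close>

lemma frechet_nth:
  assumes "(f has_derivative D) (at x)"
  shows "frechet_derivative (\<lambda>y. f y $ i) (at x) v = D v $ i"
  using frechet_derivative_at[OF bounded_linear.has_derivative[OF bounded_linear_vec_nth assms]] by metis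

lemma frechet_axis:
  fixes \<phi> :: "real^'n \<Rightarrow> real^'n"
  assumes "smooth_on S \<phi>" "x \<in> S"
  shows "frechet_derivative \<phi> (at x) v = (\<Sum>i\<in>UNIV. v $ i *\<^sub>R frechet_derivative \<phi> (at x) (axis i 1))"
  by (rule linear_axis_expansion[OF bounded_linear.linear[OF has_derivative_bounded_linear[OF smooth_on_has_derivative[OF assms]]]])

text \<open>Differentiating the system for the columns \<open>?P k\<close> and inserting it again
  writes their second derivatives as combinations of columns with coefficients \<open>?Q\<close>.
  These derivatives are symmetric in \<open>a\<close> and \<open>c\<close>, and injectivity
  separates the coefficients.\<close>

lemma integrability_of_coordinates:
  fixes \<Gamma> :: "'n::finite \<Rightarrow> 'n \<Rightarrow> 'n \<Rightarrow> real^'n \<Rightarrow> real" and \<phi> :: "real^'n \<Rightarrow> real^'n"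
  assumes S: "open S" "x \<in> S" and sm: "\<And>i j k. smooth_on S (\<Gamma> i j k)" and sm\<phi>: "smooth_on S \<phi>"
    and inj: "inj (frechet_derivative \<phi> (at x))"
    and sys: "\<And>y j k. y \<in> S \<Longrightarrow> frechet_derivative (\<lambda>y. frechet_derivative \<phi> (at y) (axis k 1)) (at y) (axis j 1) =
       (\<Sum>i\<in>UNIV. \<Gamma> i j k y *\<^sub>R frechet_derivative \<phi> (at y) (axis i 1))"
  shows "partial_deriv a (\<Gamma> l c k) x + (\<Sum>s\<in>UNIV. \<Gamma> l a s x * \<Gamma> s c k x) =
      partial_deriv c (\<Gamma> l a k) x + (\<Sum>s\<in>UNIV. \<Gamma> l c s x * \<Gamma> s a k x)"
proof -
  let ?P = "\<lambda>k y. frechet_derivative \<phi> (at y) (axis k 1)"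
  let ?Q = "\<lambda>a c l. partial_deriv a (\<Gamma> l c k) x + (\<Sum>s\<in>UNIV. \<Gamma> l a s x * \<Gamma> s c k x)"
  have smP: "smooth_on S (?P k)" for k by (rule smooth_on_frechet[OF sm\<phi>])
  note P = smooth_on_has_derivative[OF smP]
  have D1: "frechet_derivative (\<lambda>y. ?P k y $ e) (at y) (axis j 1) = (\<Sum>i\<in>UNIV. \<Gamma> i j k y * ?P i y $ e)"
    if "y \<in> S" for y j k e
    by (simp add: frechet_nth[OF P[OF that]] sys[OF that])
  have D2: "frechet_derivative (\<lambda>y. frechet_derivative (\<lambda>y. ?P k y $ e) (at y) (axis c 1)) (at x) (axis a 1) =
     (\<Sum>l\<in>UNIV. ?Q a c l * ?P l x $ e)" for a c e
  proof -
    have "frechet_derivative (\<lambda>y. frechet_derivative (\<lambda>y. ?P k y $ e) (at y) (axis c 1)) (at x) =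
        frechet_derivative (\<lambda>y. \<Sum>i\<in>UNIV. \<Gamma> i c k y * ?P i y $ e) (at x)"
      by (rule frechet_derivative_cong_open[OF S]) (rule D1)
    moreover have der: "((\<lambda>y. \<Sum>i\<in>UNIV. \<Gamma> i c k y * ?P i y $ e) has_derivative (\<lambda>h. \<Sum>i\<in>UNIV.
        \<Gamma> i c k x * (frechet_derivative (?P i) (at x) h $ e) + frechet_derivative (\<Gamma> i c k) (at x) h * ?P i x $ e)) (at x)"
      by (intro has_derivative_sum has_derivative_mult smooth_on_has_derivative[OF sm S(2)]
          bounded_linear.has_derivative[OF bounded_linear_vec_nth P[OF S(2)]])
    ultimately have "frechet_derivative (\<lambda>y. frechet_derivative (\<lambda>y. ?P k y $ e) (at y) (axis c 1)) (at x) (axis a 1) =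
        (\<Sum>i\<in>UNIV. \<Gamma> i c k x * (frechet_derivative (?P i) (at x) (axis a 1) $ e) + partial_deriv a (\<Gamma> i c k) x * ?P i x $ e)"
      using frechet_derivative_at[OF der, THEN fun_cong, of "axis a 1"] by (simp only: partial_deriv_def)
    also have "\<dots> = (\<Sum>i\<in>UNIV. \<Gamma> i c k x * (\<Sum>l\<in>UNIV. \<Gamma> l a i x * ?P l x $ e)) +
        (\<Sum>l\<in>UNIV. partial_deriv a (\<Gamma> l c k) x * ?P l x $ e)"
      by (simp add: sum.distrib sys[OF S(2)])
    also have "(\<Sum>i\<in>UNIV. \<Gamma> i c k x * (\<Sum>l\<in>UNIV. \<Gamma> l a i x * ?P l x $ e)) =
        (\<Sum>l\<in>UNIV. (\<Sum>i\<in>UNIV. \<Gamma> l a i x * \<Gamma> i c k x) * ?P l x $ e)"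
      unfolding sum_distrib_left sum_distrib_right by (subst sum.swap) (simp add: mult_ac)
    finally show ?thesis by (simp add: distrib_right sum.distrib)
  qed
  have "(\<Sum>l\<in>UNIV. ?Q a c l * ?P l x $ e) = (\<Sum>l\<in>UNIV. ?Q c a l * ?P l x $ e)" for e
  proof -
    have "Ck_on 2 S (\<lambda>y. ?P k y $ e)"
      using smP unfolding smooth_on_def by (intro Ck_on_nth S(1)) blast
    from second_derivative_symmetric[OF S this] show ?thesis by (simp add: D2[symmetric])
  qed
  \<comment> \<open>A combination of the columns is the derivative of \<phi> applied to the
    coefficient vector.\<close>
  then have "frechet_derivative \<phi> (at x) (\<chi> l. ?Q a c l) = frechet_derivative \<phi> (at x) (\<chi> l. ?Q c a l)"
    by (simp add: frechet_axis[OF sm\<phi> S(2), of "\<chi> l. ?Q a c l"] frechet_axis[OF sm\<phi> S(2), of "\<chi> l. ?Q c a l"] vec_eq_iff)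
  then have "(\<chi> l. ?Q a c l) = (\<chi> l. ?Q c a l)" using inj by (rule injD[rotated])
  then show ?thesis by (simp add: vec_eq_iff)
qed

section \<open>New charts of the maximal atlas\<close>

context manifold
begin

definition restrict_chart :: "('a, 'n) chart \<Rightarrow> (real^'n) set \<Rightarrow> (real^'n \<Rightarrow> real^'n) \<Rightarrow> ('a, 'n) chart" where
  "restrict_chart c U \<phi> = ({p \<in> chart_dom c. chart_map c p \<in> U}, \<phi> \<circ> chart_map c)"

text \<open>By maximality, compatibility with every chart suffices, and each transition map factors
  through \<open>c\<close>: out of the new chart by \<open>g\<close> followed by a transition from
  \<open>c\<close>, into it by a transition to \<open>c\<close> followed by \<phi>.\<close>

lemma restrict_chart_in_atlas:
  assumes c: "c \<in> A" and U: "open U" "U \<subseteq> chart_map c ` chart_dom c" and W: "open W"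
    and hom: "homeomorphism U W \<phi> g" and sm: "smooth_on U \<phi>" "smooth_on W g"
  shows "restrict_chart c U \<phi> \<in> A"
proof -
  let ?d = "restrict_chart c U \<phi>"
  let ?D = "{p \<in> chart_dom c. chart_map c p \<in> U}"
  have homc: "homeomorphic_map (subtopology M (chart_dom c)) (top_of_set (chart_map c ` chart_dom c)) (chart_map c)"
    using chart[OF c] by (simp add: is_chart_def)
  have DU: "chart_map c ` ?D = U" using U by auto
  have top: "topspace (subtopology M (chart_dom c)) = chart_dom c"
    using openin_subset[OF openin_dom[OF c]] by auto
  have "openin (subtopology M (chart_dom c)) {p \<in> topspace (subtopology M (chart_dom c)). chart_map c p \<in> U}"
    by (rule openin_continuous_map_preimage[OF homeomorphic_imp_continuous_map[OF homc]])
      (simp add: U open_subset)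
  then have D: "openin M ?D"
    unfolding top by (rule openin_trans_full[OF _ openin_dom[OF c]])
  have "homeomorphic_map (subtopology (subtopology M (chart_dom c)) ?D)
      (subtopology (top_of_set (chart_map c ` chart_dom c)) U) (chart_map c)"
    by (rule homeomorphic_map_subtopologies[OF homc]) (use top U DU in auto)
  moreover have "chart_dom c \<inter> ?D = ?D" "chart_map c ` chart_dom c \<inter> U = U" using U by auto
  ultimately have h1: "homeomorphic_map (subtopology M ?D) (top_of_set U) (chart_map c)"
    by (simp add: subtopology_subtopology)
  have h2: "homeomorphic_map (top_of_set U) (top_of_set W) \<phi>"
    unfolding homeomorphic_map_maps homeomorphic_maps_def
    by (rule exI[of _ g]) (use hom in \<open>auto simp: homeomorphism_def\<close>)
  have im: "(\<phi> \<circ> chart_map c) ` ?D = W"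
    using hom DU unfolding image_comp[symmetric] homeomorphism_def by metis
  have d: "is_chart M ?d"
    unfolding is_chart_def restrict_chart_def fst_conv snd_conv im
    using D W homeomorphic_map_compose[OF h1 h2] by blast
  have dom: "chart_dom ?d = ?D" and map: "chart_map ?d p = \<phi> (chart_map c p)" for p
    by (simp_all add: restrict_chart_def)
  have g: "g (chart_map ?d p) = chart_map c p" if "p \<in> ?D" for p
    using hom that unfolding map homeomorphism_def by auto
  have "smooth_compatible ?d e" if e: "e \<in> A" for e
    unfolding smooth_compatible_def
  proof
    have De: "openin M (?D \<inter> chart_dom e)" by (intro openin_Int D openin_dom e)
    have o1: "open (chart_map ?d ` (?D \<inter> chart_dom e))"
      by (rule is_chart_open_image[OF d De]) (simp add: dom)
    have o2: "open (chart_map e ` (?D \<inter> chart_dom e))"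
      by (rule is_chart_open_image[OF chart[OF e] De]) simp
    have o3: "open (chart_map c ` (?D \<inter> chart_dom e))"
      by (rule is_chart_open_image[OF chart[OF c] De]) auto
    have smo: "smooth_on (chart_map ?d ` (?D \<inter> chart_dom e)) (\<lambda>x. in_coords c (chart_map e) (g x))"
    proof (rule smooth_on_compose[where f=g and g="in_coords c (chart_map e)", OF o1 o3])
      show "g ` chart_map ?d ` (?D \<inter> chart_dom e) \<subseteq> chart_map c ` (?D \<inter> chart_dom e)"
        using g by auto
      show "smooth_on (chart_map ?d ` (?D \<inter> chart_dom e)) g"
        by (rule smooth_on_mono[OF _ sm(2)]) (use im in \<open>auto simp: map\<close>)
      show "smooth_on (chart_map c ` (?D \<inter> chart_dom e)) (in_coords c (chart_map e))"
        by (rule smooth_on_mono[OF _ transition_smooth[OF c e]]) auto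
    qed
    have eq: "in_coords c (chart_map e) (g x) = in_coords ?d (chart_map e) x"
      if x: "x \<in> chart_map ?d ` (?D \<inter> chart_dom e)" for x
    proof -
      obtain p where p: "p \<in> ?D \<inter> chart_dom e" "x = chart_map ?d p" using x by blast
      then show ?thesis
        using g[of p] in_coords_at[OF d, of p "chart_map e"] in_coords_chart[OF c, of p "chart_map e"] dom by auto
    qed
    show "smooth_on (chart_map ?d ` (chart_dom ?d \<inter> chart_dom e)) (in_coords ?d (chart_map e))"
      unfolding dom by (rule smooth_on_cong[OF o1 eq smo])
    have "smooth_on (chart_map e ` (?D \<inter> chart_dom e)) (\<lambda>x. \<phi> (in_coords e (chart_map c) x))"
    proof (rule smooth_on_compose[where f="in_coords e (chart_map c)" and g=\<phi>, OF o2 U(1) _ _ sm(1)])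
      show "in_coords e (chart_map c) ` chart_map e ` (?D \<inter> chart_dom e) \<subseteq> U"
        using in_coords_chart[OF e, of _ "chart_map c"] by auto
      show "smooth_on (chart_map e ` (?D \<inter> chart_dom e)) (in_coords e (chart_map c))"
        by (rule smooth_on_mono[OF _ transition_smooth[OF e c]]) auto
    qed
    then show "smooth_on (chart_map e ` (chart_dom ?d \<inter> chart_dom e)) (in_coords e (chart_map ?d))"
      unfolding dom by (simp add: restrict_chart_def in_coords_def comp_def)
  qed
  then show ?thesis using manifold d unfolding smooth_manifold_def by blast
qed

end

text \<open>The bilinear map with coefficients \<open>N\<close> vanishes once \<open>L\<close> is
  applied to both arguments, hence everywhere by surjectivity. This strips the Jacobian factors from
  the transformation law.\<close>

lemma bilinear_zero_of_surj:
  fixes N :: "'n::finite \<Rightarrow> 'n \<Rightarrow> real^'n" and L :: "real^'n \<Rightarrow> real^'n"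
  assumes L: "linear L" "surj L"
    and zero: "\<And>j k. (\<Sum>b\<in>UNIV. \<Sum>a\<in>UNIV. (L (axis k 1) $ b * L (axis j 1) $ a) *\<^sub>R N a b) = 0"
  shows "N a b = 0"
proof -
  define \<beta> where "\<beta> u v = (\<Sum>b\<in>UNIV. \<Sum>a\<in>UNIV. (v $ b * u $ a) *\<^sub>R N a b)" for u v
  have "bilinear (\<lambda>u v. \<beta> (L u) (L v))"
    unfolding bilinear_def \<beta>_def
    by (auto intro!: linearI simp: linear_add[OF L(1)] linear_scale[OF L(1)] algebra_simps sum.distrib scaleR_sum_right)
  moreover have "bilinear (\<lambda>(u::real^'n) (v::real^'n). 0 :: real^'n)"
    by (auto simp: bilinear_def intro!: linearI)
  ultimately have "(\<lambda>u v. \<beta> (L u) (L v)) = (\<lambda>u v. 0)"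
    by (rule bilinear_eq_stdbasis) (use zero in \<open>auto simp: Basis_vec_def \<beta>_def\<close>)
  then have "\<beta> (L u) (L v) = 0" for u v by meson
  then have "\<beta> (axis a 1) (axis b 1) = 0" using L(2) by (metis surjD)
  moreover have "\<beta> (axis a 1) (axis b 1) = N a b"
  proof -
    have 1: "(axis b (1::real) $ b' * axis a 1 $ a') *\<^sub>R N a' b' = (if a' = a then axis b 1 $ b' *\<^sub>R N a' b' else 0)"
      and 2: "axis b (1::real) $ b' *\<^sub>R N a b' = (if b' = b then N a b' else 0)" for a' b'
      by (simp_all add: axis_def)
    show ?thesis by (simp only: \<beta>_def 1 2 sum.delta finite UNIV_I if_True)
  qed
  ultimately show ?thesis by simp
qed

section \<open>The integrability condition and flat charts\<close>

context affine_manifold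
begin

text \<open>\<phi> becomes the transition map to the new chart. Its system cancels the
  second-derivative term against the left side of the transformation law, leaving only the
  pulled-back symbols of the new chart. The hypothesis \<open>flat\<close> has a form that both
  vanishing curvature and (iv) deliver.\<close>

lemma flat_chart_exists:
  assumes c: "c \<in> A" and P: "P \<in> chart_dom c"
    and sym: "\<And>x i j k. x \<in> chart_map c ` chart_dom c \<Longrightarrow> christoffel nabla c i j k x = christoffel nabla c i k j x"
    and flat: "\<And>x l a b k. x \<in> chart_map c ` chart_dom c \<Longrightarrow>
      partial_deriv a (christoffel nabla c l b k) x + (\<Sum>s\<in>UNIV. christoffel nabla c l a s x * christoffel nabla c s b k x) =
      partial_deriv b (christoffel nabla c l a k) x + (\<Sum>s\<in>UNIV. christoffel nabla c l b s x * christoffel nabla c s a k x)"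
  shows "\<exists>d\<in>A. P \<in> chart_dom d \<and> (\<forall>x \<in> chart_map d ` chart_dom d. \<forall>i j k. christoffel nabla d i j k x = 0)"
proof -
  let ?V = "chart_map c ` chart_dom c" and ?\<Gamma> = "christoffel nabla c"
  have V: "open ?V" using open_image[OF c openin_dom[OF c]] by simp
  show ?thesis
  proof (rule flat_coordinates[OF V imageI[OF P] christoffel_smooth[OF c] sym flat])
    fix U W and \<phi> :: "real^'n \<Rightarrow> real^'n" and g
    assume U: "open U" "chart_map c P \<in> U" "U \<subseteq> ?V" and W: "open W" "homeomorphism U W \<phi> g"
      and sm: "smooth_on U \<phi>" "smooth_on W g" and bij: "\<And>x. x \<in> U \<Longrightarrow> bij (frechet_derivative \<phi> (at x))"
      and sys: "\<And>x j k. x \<in> U \<Longrightarrow> frechet_derivative (\<lambda>y. frechet_derivative \<phi> (at y) (axis k 1)) (at x) (axis j 1) =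
         (\<Sum>i\<in>UNIV. ?\<Gamma> i j k x *\<^sub>R frechet_derivative \<phi> (at x) (axis i 1))"
    define d where "d = restrict_chart c U \<phi>"
    have d: "d \<in> A" unfolding d_def by (rule restrict_chart_in_atlas[OF c U(1,3) W sm])
    have dom: "chart_dom d = {p \<in> chart_dom c. chart_map c p \<in> U}" by (simp add: d_def restrict_chart_def)
    have "christoffel nabla d i a b (chart_map d p) = 0" if p: "p \<in> chart_dom d" for p i a b
    proof -
      let ?x = "chart_map c p" and ?\<psi> = "in_coords c (chart_map d)"
      have x: "?x \<in> U" and p': "p \<in> chart_dom c \<inter> chart_dom d" using p dom by auto
      \<comment> \<open>Agreement with \<phi> is available on \<open>U\<close>, whose openness
        transfers first and second derivatives.\<close>
      have \<psi>: "?\<psi> y = \<phi> y" if "y \<in> U" for y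
        using that U(3) in_coords_chart[OF c, of _ "chart_map d"] by (auto simp: d_def restrict_chart_def)
      have D: "frechet_derivative ?\<psi> (at y) = frechet_derivative \<phi> (at y)" if "y \<in> U" for y
        by (rule frechet_derivative_cong_open[OF U(1) that \<psi>])
      have D2: "frechet_derivative (\<lambda>y. frechet_derivative ?\<psi> (at y) (axis k 1)) (at ?x) =
          frechet_derivative (\<lambda>y. frechet_derivative \<phi> (at y) (axis k 1)) (at ?x)" for k
        by (rule frechet_derivative_cong_open[OF U(1) x]) (simp add: D)
      let ?L = "frechet_derivative \<phi> (at ?x)"
      have "(\<Sum>b\<in>UNIV. \<Sum>a\<in>UNIV. (?L (axis k 1) $ b * ?L (axis j 1) $ a) *\<^sub>R (\<chi> i. christoffel nabla d i a b (chart_map d p))) = 0" for j k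
        using christoffel_transformation[OF c d p', of j k] by (simp add: D[OF x] D2 sys[OF x])
      moreover have "linear ?L"
        by (rule bounded_linear.linear[OF has_derivative_bounded_linear[OF smooth_on_has_derivative[OF sm(1) x]]])
      ultimately have "(\<chi> i. christoffel nabla d i a b (chart_map d p)) = 0"
        by (intro bilinear_zero_of_surj[where L="?L" and N="\<lambda>a b. \<chi> i. christoffel nabla d i a b (chart_map d p)"]
            bij_is_surj bij x)
      then show ?thesis by (simp add: vec_eq_iff)
    qed
    moreover have "P \<in> chart_dom d" using P U(2) dom by blast
    ultimately show ?thesis using d by (intro bexI[of _ d]) auto
  qed
qed

text \<open>With zero symbols in \<open>d\<close>, the transformation law says that the transition
  map from \<open>c\<close> to \<open>d\<close> solves the coordinate system on the overlap; its
  derivative has a left inverse, that of the reverse transition.\<close>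

lemma flat_of_flat_chart:
  assumes c: "c \<in> A" and d: "d \<in> A" and p: "p \<in> chart_dom c \<inter> chart_dom d"
    and zero: "\<And>x i j k. x \<in> chart_map d ` chart_dom d \<Longrightarrow> christoffel nabla d i j k x = 0"
  shows "partial_deriv a (christoffel nabla c l b k) (chart_map c p) +
      (\<Sum>s\<in>UNIV. christoffel nabla c l a s (chart_map c p) * christoffel nabla c s b k (chart_map c p)) =
    partial_deriv b (christoffel nabla c l a k) (chart_map c p) +
      (\<Sum>s\<in>UNIV. christoffel nabla c l b s (chart_map c p) * christoffel nabla c s a k (chart_map c p))"
proof (rule integrability_of_coordinates)
  let ?W = "chart_dom c \<inter> chart_dom d"
  show "open (chart_map c ` ?W)"
    by (rule is_chart_open_image[OF chart[OF c]]) (auto intro: openin_Int openin_dom c d)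
  show "chart_map c p \<in> chart_map c ` ?W" using p by blast
  show "smooth_on (chart_map c ` ?W) (christoffel nabla c i j k)" for i j k
    by (rule smooth_on_mono[OF _ christoffel_smooth[OF c]]) auto
  show "smooth_on (chart_map c ` ?W) (in_coords c (chart_map d))" by (rule transition_smooth[OF c d])
  show "inj (frechet_derivative (in_coords c (chart_map d)) (at (chart_map c p)))"
    by (rule inj_on_inverseI) (rule transition_inverse[OF c d p])
  fix y j k assume "y \<in> chart_map c ` ?W"
  then obtain q where q: "q \<in> ?W" "y = chart_map c q" by blast
  have "(\<chi> i. christoffel nabla d i a b (chart_map d q)) = 0" for a b
    using zero[OF imageI[of q]] q(1) by (simp add: vec_eq_iff)
  then show "frechet_derivative (\<lambda>y. frechet_derivative (in_coords c (chart_map d)) (at y) (axis k 1)) (at y) (axis j 1) =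
       (\<Sum>i\<in>UNIV. christoffel nabla c i j k y *\<^sub>R frechet_derivative (in_coords c (chart_map d)) (at y) (axis i 1))"
    using christoffel_transformation[OF c d q(1), of j k] q(2) by simp
qed

text \<open>Symmetry moves \<open>k\<close> to the last lower place. It holds on the whole open
  image of the chart, hence also under the partial derivatives.\<close>

lemma curvature_eq_zero_iff:
  assumes c: "c \<in> A" and x: "x \<in> chart_map c ` chart_dom c"
    and sym: "\<And>x i j k. x \<in> chart_map c ` chart_dom c \<Longrightarrow> christoffel nabla c i j k x = christoffel nabla c i k j x"
  shows "curvature nabla c l k a b x = 0 \<longleftrightarrow>
    partial_deriv a (christoffel nabla c l b k) x + (\<Sum>s\<in>UNIV. christoffel nabla c l a s x * christoffel nabla c s b k x) =
    partial_deriv b (christoffel nabla c l a k) x + (\<Sum>s\<in>UNIV. christoffel nabla c l b s x * christoffel nabla c s a k x)"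
proof -
  have V: "open (chart_map c ` chart_dom c)" using open_image[OF c openin_dom[OF c]] by simp
  have "partial_deriv a (christoffel nabla c l k b) x = partial_deriv a (christoffel nabla c l b k) x" for a b
    unfolding partial_deriv_def by (subst frechet_derivative_cong_open[OF V x sym]) auto
  then show ?thesis unfolding curvature_def Let_def using sym[OF x, of _ k] by (simp add: algebra_simps)
qed

end

theorem theorem2p6:
  fixes M :: "'a topology"
    and A :: "('a, 'n::finite) chart set"
    and nabla :: "('a, 'n) cov_deriv"
  assumes "smooth_manifold M A"
    and "symmetric_affine_connection M A nabla"
  shows
    "(curvature_flat A nabla \<longleftrightarrow>
       (\<forall>P \<in> topspace M. \<exists>c\<in>A. P \<in> chart_dom c \<and>
          (\<forall>x \<in> chart_map c ` chart_dom c. \<forall>i j k. christoffel nabla c i j k x = 0))) \<and>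
     (curvature_flat A nabla \<longleftrightarrow>
       (\<forall>P \<in> topspace M. \<exists>c\<in>A. P \<in> chart_dom c \<and>
          (\<forall>x \<in> chart_map c ` chart_dom c. \<forall>p l i s.
             partial_deriv p (christoffel nabla c l i s) x = 0 \<and>
             (\<Sum>n\<in>UNIV. christoffel nabla c l p n x * christoffel nabla c n i s x) = 0))) \<and>
     (curvature_flat A nabla \<longleftrightarrow>
       (\<forall>P \<in> topspace M. \<exists>c\<in>A. P \<in> chart_dom c \<and>
          (\<forall>x \<in> chart_map c ` chart_dom c. \<forall>p l i s.
             partial_deriv p (christoffel nabla c l i s) x
             + (\<Sum>n\<in>UNIV. christoffel nabla c l p n x * christoffel nabla c n i s x) = 0)))"
proof -
  interpret affine_manifold M A nabla
    by standard (use assms in \<open>auto simp: symmetric_affine_connection_def\<close>)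
  let ?\<Gamma> = "christoffel nabla"
  let ?ii = "\<lambda>c. \<forall>x \<in> chart_map c ` chart_dom c. \<forall>i j k. ?\<Gamma> c i j k x = 0"
  let ?iii = "\<lambda>c. \<forall>x \<in> chart_map c ` chart_dom c. \<forall>p l i s.
     partial_deriv p (?\<Gamma> c l i s) x = 0 \<and> (\<Sum>n\<in>UNIV. ?\<Gamma> c l p n x * ?\<Gamma> c n i s x) = 0"
  let ?iv = "\<lambda>c. \<forall>x \<in> chart_map c ` chart_dom c. \<forall>p l i s.
     partial_deriv p (?\<Gamma> c l i s) x + (\<Sum>n\<in>UNIV. ?\<Gamma> c l p n x * ?\<Gamma> c n i s x) = 0"
  let ?around = "\<lambda>Q. \<forall>P \<in> topspace M. \<exists>c\<in>A. P \<in> chart_dom c \<and> Q c"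
  have sym: "?\<Gamma> c i j k x = ?\<Gamma> c i k j x" if "c \<in> A" "x \<in> chart_map c ` chart_dom c" for c i j k x
    using assms(2) that unfolding symmetric_affine_connection_def by blast
  have top: "topspace M = (\<Union>c\<in>A. chart_dom c)" using assms(1) unfolding smooth_manifold_def by blast
  have "?around ?ii" if flat: "curvature_flat A nabla"
  proof
    fix P assume "P \<in> topspace M"
    then obtain c where c: "c \<in> A" "P \<in> chart_dom c" using top by blast
    show "\<exists>c\<in>A. P \<in> chart_dom c \<and> ?ii c"
    proof (rule flat_chart_exists[OF c sym[OF c(1)]])
      fix x l a b k assume x: "x \<in> chart_map c ` chart_dom c"
      show "partial_deriv a (?\<Gamma> c l b k) x + (\<Sum>s\<in>UNIV. ?\<Gamma> c l a s x * ?\<Gamma> c s b k x) =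
        partial_deriv b (?\<Gamma> c l a k) x + (\<Sum>s\<in>UNIV. ?\<Gamma> c l b s x * ?\<Gamma> c s a k x)"
        using flat c(1) x curvature_eq_zero_iff[OF c(1) x sym[OF c(1)]] unfolding curvature_flat_def by blast
    qed
  qed
  moreover have "?iii c" if c: "c \<in> A" and z: "?ii c" for c
  proof (intro ballI allI conjI)
    fix x p l i s assume x: "x \<in> chart_map c ` chart_dom c"
    have V: "open (chart_map c ` chart_dom c)" using open_image[OF c openin_dom[OF c]] by simp
    have "frechet_derivative (?\<Gamma> c l i s) (at x) = frechet_derivative (\<lambda>_. 0) (at x)"
      by (rule frechet_derivative_cong_open[OF V x]) (use z in blast)
    then show "partial_deriv p (?\<Gamma> c l i s) x = 0" by (simp add: partial_deriv_def)
    have "?\<Gamma> c i j k x = 0" for i j k using z x by blast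
    then show "(\<Sum>n\<in>UNIV. ?\<Gamma> c l p n x * ?\<Gamma> c n i s x) = 0" by simp
  qed
  then have "?around ?ii \<Longrightarrow> ?around ?iii" by meson
  moreover have "?iv c" if "?iii c" for c
    using that by simp
  then have "?around ?iii \<Longrightarrow> ?around ?iv" by meson
  moreover have "?around ?ii" if iv: "?around ?iv"
  proof
    fix P assume "P \<in> topspace M"
    then obtain c where c: "c \<in> A" "P \<in> chart_dom c" "?iv c" using iv by meson
    show "\<exists>c\<in>A. P \<in> chart_dom c \<and> ?ii c"
    proof (rule flat_chart_exists[OF c(1,2) sym[OF c(1)]])
      fix x l a b k assume "x \<in> chart_map c ` chart_dom c"
      \<comment> \<open>(iv) is available for all indices, so both sides of the integrability
        condition vanish separately.\<close>
      then have "partial_deriv p (?\<Gamma> c l i s) x + (\<Sum>n\<in>UNIV. ?\<Gamma> c l p n x * ?\<Gamma> c n i s x) = 0" for p i s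
        using c(3) by blast
      then show "partial_deriv a (?\<Gamma> c l b k) x + (\<Sum>s\<in>UNIV. ?\<Gamma> c l a s x * ?\<Gamma> c s b k x) =
        partial_deriv b (?\<Gamma> c l a k) x + (\<Sum>s\<in>UNIV. ?\<Gamma> c l b s x * ?\<Gamma> c s a k x)"
        by (simp only:)
    qed
  qed
  moreover have "curvature_flat A nabla" if ii: "?around ?ii"
    unfolding curvature_flat_def
  proof (intro ballI allI)
    fix c x l k a b assume c: "c \<in> A" and x: "x \<in> chart_map c ` chart_dom c"
    obtain p where p: "p \<in> chart_dom c" "x = chart_map c p" using x by blast
    with c top have "p \<in> topspace M" by blast
    \<comment> \<open>Curvature is tested in an arbitrary chart \<open>c\<close>, point by point,
      against a flat chart \<open>d\<close> around the point.\<close>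
    then obtain d where d: "d \<in> A" "p \<in> chart_dom d" "?ii d" using ii by meson
    have "partial_deriv a (?\<Gamma> c l b k) x + (\<Sum>s\<in>UNIV. ?\<Gamma> c l a s x * ?\<Gamma> c s b k x) =
        partial_deriv b (?\<Gamma> c l a k) x + (\<Sum>s\<in>UNIV. ?\<Gamma> c l b s x * ?\<Gamma> c s a k x)"
      unfolding p(2) by (rule flat_of_flat_chart[OF c d(1)]) (use p d in auto)
    then show "curvature nabla c l k a b x = 0"
      using curvature_eq_zero_iff[OF c x sym[OF c]] by blast
  qed
  \<comment> \<open>The implications (i) to (ii) to (iii) to (iv) to (ii) to (i) leave propositional
    reasoning only.\<close>
  ultimately show ?thesis by argo
qed

end
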